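(* Let $\mathcal{A}$ be a $C^*$-algebra or a real $C^*$-algebra or a JC-algebra, with a unit, and let $A$ and $B$ be two positive invertible elements in $\mathcal{A}$. Let $\alpha\geq 0$, $\beta\geq 0$. If $\delta\geq 1$ and $\delta A^{\beta}\leq B$, then $$\mathrm{I}'\leq \mathrm{II}'\leq S_{\alpha,\beta}(A|B)\leq \mathrm{III}'\leq \mathrm{V}'.$$ If $0<\delta\leq 1$ and $B\leq \delta A^{\beta}$, the reversed inequalities hold, i.e. $$\mathrm{V}'\leq \mathrm{III}'\leq S_{\alpha,\beta}(A|B)\leq \mathrm{II}'\leq \mathrm{I}'.$$
   Context: A JC-algebra is a norm-closed Jordan subalgebra of $B(H)_{sa}$, the self-adjoint bounded operators on a complex Hilbert space $H$, with Jordan product $A\circ B=\frac12(AB+BA)$, ordered by the cone of positive operators. In the JC case, products are computed in the ambient $B(H)$ (with $ABA=2(A\circ B)\circ A-A^2\circ B$), and all expressions below belong to $\mathcal{A}$. For self-adjoint elements, $X\leq Y$ means $Y-X$ is positive. Real powers, logarithms and inverses are taken by continuous functional calculus for self-adjoint elements; scalars are identified with multiples of the unit of $\mathcal{A}$. For positive invertible $A,B\in\mathcal{A}$ put $X=A^{-\frac{\beta}{2}}BA^{-\frac{\beta}{2}}$. For real $\alpha,\beta$, the relative operator $(\alpha,\beta)$-entropy is $S_{\alpha,\beta}(A|B)=A^{\frac{\beta}{2}}\left[X^{\alpha}\log X\right]A^{\frac{\beta}{2}}$ and the operator $(\alpha,\beta)$-geometric mean is $A\#_{(\alpha,\beta)}B=A^{\frac{\beta}{2}}X^{\alpha}A^{\frac{\beta}{2}}$.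 For $\delta>0$ and $\alpha,\beta$ as in the claim set $$\mathrm{I}'=(\ln\delta+2)A\#_{(\alpha,\beta)}B-4\delta A^{\frac{\beta}{2}}\left[(X+\delta)^{-1}X^{\alpha}\right]A^{\frac{\beta}{2}},$$ $$\mathrm{II}'=(\ln\delta+4)A\#_{(\alpha,\beta)}B-8\sqrt{\delta}\,A^{\frac{\beta}{2}}\left[\left(X^{\frac12}+\sqrt{\delta}\right)^{-1}X^{\alpha}\right]A^{\frac{\beta}{2}},$$ $$\mathrm{III}'=\left(\tfrac{1}{\sqrt{\delta}}A\#_{(\alpha+\frac12,\beta)}B-\sqrt{\delta}\,A\#_{(\alpha-\frac12,\beta)}B\right)+(\ln\delta)\, A\#_{(\alpha,\beta)}B,$$ $$\mathrm{V}'=\tfrac12\left(\tfrac{1}{\delta}A\#_{(\alpha+1,\beta)}B-\delta A\#_{(\alpha-1,\beta)}B\right)+(\ln\delta)\, A\#_{(\alpha,\beta)}B.$$ *)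

theory Defs
  imports "HOL-Analysis.Analysis" "HOL-Computational_Algebra.Polynomial"
begin

section \<open>Complex scalars and complex Hilbert spaces\<close>

class complex_scalar_space = real_vector +
  fixes scaleC :: "complex \<Rightarrow> 'a \<Rightarrow> 'a" (infixr \<open>*\<^sub>C\<close> 75)
  assumes scaleC_add_right: "z *\<^sub>C (x + y) = z *\<^sub>C x + z *\<^sub>C y"
    and scaleC_add_left: "(z + w) *\<^sub>C x = z *\<^sub>C x + w *\<^sub>C x"
    and scaleC_scaleC: "z *\<^sub>C w *\<^sub>C x = (z * w) *\<^sub>C x"
    and scaleR_scaleC: "r *\<^sub>R x = complex_of_real r *\<^sub>C x"

class complex_hilbert = complex_scalar_space + real_normed_vector + complete_space +
  fixes cinner :: "'a \<Rightarrow> 'a \<Rightarrow> complex"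
  assumes cinner_commute: "cinner x y = cnj (cinner y x)"
    and cinner_add_right: "cinner x (y + z) = cinner x y + cinner x z"
    and cinner_scaleC_right: "cinner x (c *\<^sub>C y) = c * cinner x y"
    and cinner_self: "cinner x x = complex_of_real ((norm x)\<^sup>2)"


section \<open>Unital real and complex C*-algebras\<close>

class cstar_identity_algebra = real_normed_algebra_1 + complete_space +
  fixes adj :: "'a \<Rightarrow> 'a"
  assumes adj_adj: "adj (adj x) = x"
    and adj_add: "adj (x + y) = adj x + adj y"
    and adj_scaleR: "adj (r *\<^sub>R x) = r *\<^sub>R adj x"
    and adj_mult: "adj (x * y) = adj y * adj x"
    and cstar_identity: "norm (adj x * x) = (norm x)\<^sup>2"

class cstar_algebra = cstar_identity_algebra + complex_scalar_space +
  assumes mult_scaleC_left: "(z *\<^sub>C x) * y = z *\<^sub>C (x * y)"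
    and mult_scaleC_right: "x * (z *\<^sub>C y) = z *\<^sub>C (x * y)"
    and norm_scaleC: "norm (z *\<^sub>C x) = cmod z * norm x"
    and adj_scaleC: "adj (z *\<^sub>C x) = cnj z *\<^sub>C adj x"

text \<open>Over the reals the C*-identity alone is not enough: one also requires that all
  elements \<open>1 + x* x\<close> are invertible. These are the usual intrinsic axioms for real
  C*-algebras (equivalently: norm-closed real *-algebras of operators on a Hilbert space).\<close>

class real_cstar_algebra = cstar_identity_algebra +
  assumes one_plus_invertible: "\<exists>y. (1 + adj x * x) * y = 1 \<and> y * (1 + adj x * x) = 1"


section \<open>The algebra B(H)\<close>

typedef (overloaded) 'h cbop =
  "{f :: 'h::complex_hilbert \<Rightarrow>\<^sub>L 'h. \<forall>z x. blinfun_apply f (z *\<^sub>C x) = z *\<^sub>C blinfun_apply f x}"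
  morphisms op_blinfun Cbop
proof -
  have "z *\<^sub>C (0::'h) = 0" for z
    using scaleC_add_right[of z "0::'h" 0] by simp
  then show ?thesis by (intro exI[of _ 0]) simp
qed

setup_lifting type_definition_cbop

abbreviation op_apply :: "'h::complex_hilbert cbop \<Rightarrow> 'h \<Rightarrow> 'h"
  where "op_apply T \<equiv> blinfun_apply (op_blinfun T)"

lemma scaleC_zero_right: "z *\<^sub>C (0::'a::complex_scalar_space) = 0"
  using scaleC_add_right[of z "0::'a" 0] by simp

lemma scaleC_minus_right: "z *\<^sub>C (- x) = - (z *\<^sub>C (x::'a::complex_scalar_space))"
  using scaleC_add_right[of z x "- x"] by (simp add: scaleC_zero_right eq_neg_iff_add_eq_0 add.commute)

lemma scaleC_diff_right: "z *\<^sub>C (x - y) = z *\<^sub>C x - z *\<^sub>C (y::'a::complex_scalar_space)"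
  using scaleC_add_right[of z x "- y"] by (simp add: scaleC_minus_right)

lemma scaleC_scaleR_commute: "z *\<^sub>C r *\<^sub>R x = r *\<^sub>R z *\<^sub>C (x::'a::complex_scalar_space)"
  by (simp add: scaleR_scaleC scaleC_scaleC mult.commute)

instantiation cbop :: (complex_hilbert) real_normed_algebra
begin

lift_definition zero_cbop :: "'a cbop" is 0
  by (simp add: scaleC_zero_right)

lift_definition plus_cbop :: "'a cbop \<Rightarrow> 'a cbop \<Rightarrow> 'a cbop" is "(+)"
  by (simp add: blinfun.add_left scaleC_add_right)

lift_definition minus_cbop :: "'a cbop \<Rightarrow> 'a cbop \<Rightarrow> 'a cbop" is "(-)"
  by (simp add: blinfun.diff_left scaleC_diff_right)

lift_definition uminus_cbop :: "'a cbop \<Rightarrow> 'a cbop" is uminus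
  by (simp add: blinfun.minus_left scaleC_minus_right)

lift_definition scaleR_cbop :: "real \<Rightarrow> 'a cbop \<Rightarrow> 'a cbop" is "(*\<^sub>R)"
  by (simp add: blinfun.scaleR_left scaleC_scaleR_commute)

lift_definition times_cbop :: "'a cbop \<Rightarrow> 'a cbop \<Rightarrow> 'a cbop" is "(o\<^sub>L)"
  by simp

lift_definition norm_cbop :: "'a cbop \<Rightarrow> real" is norm .

definition dist_cbop :: "'a cbop \<Rightarrow> 'a cbop \<Rightarrow> real"
  where "dist_cbop S T = norm (S - T)"

definition sgn_cbop :: "'a cbop \<Rightarrow> 'a cbop"
  where "sgn_cbop T = inverse (norm T) *\<^sub>R T"

definition uniformity_cbop :: "('a cbop \<times> 'a cbop) filter"
  where "uniformity_cbop = (INF e\<in>{0 <..}. principal {(S, T). dist S T < e})"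

definition open_cbop :: "'a cbop set \<Rightarrow> bool"
  where "open_cbop U = (\<forall>S\<in>U. \<forall>\<^sub>F (S', T) in uniformity. S' = S \<longrightarrow> T \<in> U)"

instance
proof
  fix S T U :: "'a cbop" and r s :: real
  show "S + T + U = S + (T + U)" by transfer simp
  show "S + T = T + S" by transfer simp
  show "0 + S = S" by transfer simp
  show "- S + S = 0" by transfer simp
  show "S - T = S + - T" by transfer simp
  show "r *\<^sub>R (S + T) = r *\<^sub>R S + r *\<^sub>R T" by transfer (simp add: scaleR_right_distrib)
  show "(r + s) *\<^sub>R S = r *\<^sub>R S + s *\<^sub>R S" by transfer (simp add: scaleR_left_distrib)
  show "r *\<^sub>R s *\<^sub>R S = (r * s) *\<^sub>R S" by transfer simp
  show "1 *\<^sub>R S = S" by transfer simp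
  show "S * T * U = S * (T * U)" by transfer (simp add: blinfun_eqI)
  show "(S + T) * U = S * U + T * U"
    by transfer (simp add: blinfun_eqI blinfun.add_left)
  show "S * (T + U) = S * T + S * U"
    by transfer (simp add: blinfun_eqI blinfun.add_left blinfun.add_right)
  show "r *\<^sub>R S * T = r *\<^sub>R (S * T)"
    by transfer (simp add: blinfun_eqI blinfun.scaleR_left)
  show "S * r *\<^sub>R T = r *\<^sub>R (S * T)"
    by transfer (simp add: blinfun_eqI blinfun.scaleR_left blinfun.scaleR_right)
  show "dist S T = norm (S - T)" by (rule dist_cbop_def)
  show "sgn S = inverse (norm S) *\<^sub>R S" by (rule sgn_cbop_def)
  show "uniformity = (INF e\<in>{0 <..}. principal {(S, T :: 'a cbop). dist S T < e})"
    by (rule uniformity_cbop_def)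
  show "open V = (\<forall>S\<in>V. \<forall>\<^sub>F (S', T) in uniformity. S' = S \<longrightarrow> T \<in> V)" for V :: "'a cbop set"
    by (rule open_cbop_def)
  show "(norm S = 0) = (S = 0)" by transfer simp
  show "norm (S + T) \<le> norm S + norm T" by transfer (rule norm_triangle_ineq)
  show "norm (r *\<^sub>R S) = \<bar>r\<bar> * norm S" by transfer simp
  show "norm (S * T) \<le> norm S * norm T" by transfer (rule norm_blinfun_compose)
qed

end


section \<open>JC-algebras\<close>

definition selfadjoint_op :: "'h::complex_hilbert cbop \<Rightarrow> bool"
  where "selfadjoint_op T \<longleftrightarrow> (\<forall>x y. cinner (op_apply T x) y = cinner x (op_apply T y))"

definition jordan_prod :: "'h::complex_hilbert cbop \<Rightarrow> 'h cbop \<Rightarrow> 'h cbop"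
  where "jordan_prod S T = (1 / 2) *\<^sub>R (S * T + T * S)"

definition JC_algebra :: "'h::complex_hilbert cbop set \<Rightarrow> bool"
  where "JC_algebra \<A> \<longleftrightarrow> subspace \<A> \<and> closed \<A> \<and> (\<forall>T\<in>\<A>. selfadjoint_op T) \<and>
    (\<forall>S\<in>\<A>. \<forall>T\<in>\<A>. jordan_prod S T \<in> \<A>)"

text \<open>The unit of a JC-algebra is a projection in B(H); it need not be the identity operator.\<close>

definition jordan_unit :: "'h::complex_hilbert cbop set \<Rightarrow> 'h cbop \<Rightarrow> bool"
  where "jordan_unit \<A> e \<longleftrightarrow> e \<in> \<A> \<and> (\<forall>T\<in>\<A>. jordan_prod e T = T)"


section \<open>Invertibility and continuous functional calculus\<close>

text \<open>The following definitions are relative to an ambient algebra, a subset \<open>\<A>\<close> of it and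
  the unit \<open>e\<close> of \<open>\<A>\<close>. For (real) C*-algebras these are \<open>UNIV\<close> and \<open>1\<close>; for JC-algebras the
  ambient algebra is B(H). For a JC-algebra, an inverse \<open>b \<in> \<A>\<close> with respect to the operator
  product is the same as an inverse in the Jordan sense.\<close>

definition invertible_in :: "'a::real_normed_algebra set \<Rightarrow> 'a \<Rightarrow> 'a \<Rightarrow> bool"
  where "invertible_in \<A> e a \<longleftrightarrow> a \<in> \<A> \<and> (\<exists>b\<in>\<A>. a * b = e \<and> b * a = e)"

definition real_spectrum :: "'a::real_normed_algebra set \<Rightarrow> 'a \<Rightarrow> 'a \<Rightarrow> real set"
  where "real_spectrum \<A> e a = {t. \<not> invertible_in \<A> e (a - t *\<^sub>R e)}"

primrec power_in :: "'a::real_normed_algebra \<Rightarrow> 'a \<Rightarrow> nat \<Rightarrow> 'a"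
  where "power_in e a 0 = e"
  | "power_in e a (Suc n) = a * power_in e a n"

definition poly_in :: "'a::real_normed_algebra \<Rightarrow> real poly \<Rightarrow> 'a \<Rightarrow> 'a"
  where "poly_in e p a = (\<Sum>i\<le>degree p. coeff p i *\<^sub>R power_in e a i)"

text \<open>Continuous functional calculus of a self-adjoint element \<open>a\<close>, whose spectrum is real:
  \<open>f(a)\<close> is the limit of \<open>p\<^sub>n(a)\<close> for any real polynomials \<open>p\<^sub>n\<close> that converge to \<open>f\<close>
  uniformly on the spectrum of \<open>a\<close>.\<close>

definition cfc :: "'a::real_normed_algebra set \<Rightarrow> 'a \<Rightarrow> (real \<Rightarrow> real) \<Rightarrow> 'a \<Rightarrow> 'a"
  where "cfc \<A> e f a = (THE b. \<exists>p :: nat \<Rightarrow> real poly.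
    uniform_limit (real_spectrum \<A> e a) (\<lambda>n. poly (p n)) f sequentially \<and>
    (\<lambda>n. poly_in e (p n) a) \<longlonglongrightarrow> b)"


section \<open>Positivity and order\<close>

definition cstar_spectrum :: "'a::cstar_algebra \<Rightarrow> complex set"
  where "cstar_spectrum a = {z. \<not> invertible_in UNIV 1 (a - z *\<^sub>C 1)}"

text \<open>The spectrum of an element \<open>a\<close> of a real algebra is its spectrum in the complexification:
  \<open>a - (s + it)\<close> is invertible there iff \<open>(a - s)\<^sup>2 + t\<^sup>2\<close> is invertible in the algebra.\<close>

definition real_cstar_spectrum :: "'a::real_cstar_algebra \<Rightarrow> complex set"
  where "real_cstar_spectrum a =
    {z. \<not> invertible_in UNIV 1 ((a - Re z *\<^sub>R 1)\<^sup>2 + (Im z)\<^sup>2 *\<^sub>R 1)}"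

definition cstar_positive :: "'a::cstar_algebra \<Rightarrow> bool"
  where "cstar_positive a \<longleftrightarrow> adj a = a \<and> cstar_spectrum a \<subseteq> \<real>\<^sub>\<ge>\<^sub>0"

definition real_cstar_positive :: "'a::real_cstar_algebra \<Rightarrow> bool"
  where "real_cstar_positive a \<longleftrightarrow> adj a = a \<and> real_cstar_spectrum a \<subseteq> \<real>\<^sub>\<ge>\<^sub>0"

definition op_positive :: "'h::complex_hilbert cbop \<Rightarrow> bool"
  where "op_positive T \<longleftrightarrow> selfadjoint_op T \<and> (\<forall>x. cinner x (op_apply T x) \<in> \<real>\<^sub>\<ge>\<^sub>0)"

definition cstar_le :: "'a::cstar_algebra \<Rightarrow> 'a \<Rightarrow> bool"  (infix \<open>\<preceq>\<^sub>C\<close> 50)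
  where "X \<preceq>\<^sub>C Y \<longleftrightarrow> cstar_positive (Y - X)"

definition real_cstar_le :: "'a::real_cstar_algebra \<Rightarrow> 'a \<Rightarrow> bool"  (infix \<open>\<preceq>\<^sub>R\<close> 50)
  where "X \<preceq>\<^sub>R Y \<longleftrightarrow> real_cstar_positive (Y - X)"

definition op_le :: "'h::complex_hilbert cbop \<Rightarrow> 'h cbop \<Rightarrow> bool"  (infix \<open>\<preceq>\<^sub>H\<close> 50)
  where "X \<preceq>\<^sub>H Y \<longleftrightarrow> op_positive (Y - X)"


section \<open>Relative operator entropy, geometric mean and the bounds\<close>

context
  fixes \<A> :: "'a::real_normed_algebra set" and e :: 'a
begin

definition rpow :: "'a \<Rightarrow> real \<Rightarrow> 'a"
  where "rpow a r = cfc \<A> e (\<lambda>t. t powr r) a"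

definition alg_log :: "'a \<Rightarrow> 'a"
  where "alg_log a = cfc \<A> e ln a"

definition alg_inv :: "'a \<Rightarrow> 'a"
  where "alg_inv a = cfc \<A> e inverse a"

definition rel_elem :: "real \<Rightarrow> 'a \<Rightarrow> 'a \<Rightarrow> 'a"
  where "rel_elem \<beta> A B = rpow A (- \<beta> / 2) * B * rpow A (- \<beta> / 2)"

definition rel_entropy :: "real \<Rightarrow> real \<Rightarrow> 'a \<Rightarrow> 'a \<Rightarrow> 'a"
  where "rel_entropy \<alpha> \<beta> A B = (let X = rel_elem \<beta> A B in
    rpow A (\<beta> / 2) * (rpow X \<alpha> * alg_log X) * rpow A (\<beta> / 2))"

definition geo_mean :: "real \<Rightarrow> real \<Rightarrow> 'a \<Rightarrow> 'a \<Rightarrow> 'a"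
  where "geo_mean \<alpha> \<beta> A B = rpow A (\<beta> / 2) * rpow (rel_elem \<beta> A B) \<alpha> * rpow A (\<beta> / 2)"

definition bound_I :: "real \<Rightarrow> real \<Rightarrow> real \<Rightarrow> 'a \<Rightarrow> 'a \<Rightarrow> 'a"
  where "bound_I \<delta> \<alpha> \<beta> A B = (let X = rel_elem \<beta> A B in
    (ln \<delta> + 2) *\<^sub>R geo_mean \<alpha> \<beta> A B
    - (4 * \<delta>) *\<^sub>R (rpow A (\<beta> / 2) * (alg_inv (X + \<delta> *\<^sub>R e) * rpow X \<alpha>) * rpow A (\<beta> / 2)))"

definition bound_II :: "real \<Rightarrow> real \<Rightarrow> real \<Rightarrow> 'a \<Rightarrow> 'a \<Rightarrow> 'a"
  where "bound_II \<delta> \<alpha> \<beta> A B = (let X = rel_elem \<beta> A B in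
    (ln \<delta> + 4) *\<^sub>R geo_mean \<alpha> \<beta> A B
    - (8 * sqrt \<delta>) *\<^sub>R
      (rpow A (\<beta> / 2) * (alg_inv (rpow X (1 / 2) + sqrt \<delta> *\<^sub>R e) * rpow X \<alpha>) * rpow A (\<beta> / 2)))"

definition bound_III :: "real \<Rightarrow> real \<Rightarrow> real \<Rightarrow> 'a \<Rightarrow> 'a \<Rightarrow> 'a"
  where "bound_III \<delta> \<alpha> \<beta> A B =
    ((1 / sqrt \<delta>) *\<^sub>R geo_mean (\<alpha> + 1 / 2) \<beta> A B - sqrt \<delta> *\<^sub>R geo_mean (\<alpha> - 1 / 2) \<beta> A B)
    + ln \<delta> *\<^sub>R geo_mean \<alpha> \<beta> A B"

definition bound_V :: "real \<Rightarrow> real \<Rightarrow> real \<Rightarrow> 'a \<Rightarrow> 'a \<Rightarrow> 'a"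
  where "bound_V \<delta> \<alpha> \<beta> A B =
    (1 / 2) *\<^sub>R ((1 / \<delta>) *\<^sub>R geo_mean (\<alpha> + 1) \<beta> A B - \<delta> *\<^sub>R geo_mean (\<alpha> - 1) \<beta> A B)
    + ln \<delta> *\<^sub>R geo_mean \<alpha> \<beta> A B"

end

end

theory Submission
  imports Defs "HOL-Computational_Algebra.Fundamental_Theorem_Algebra"
begin

text \<open>The self-adjoint part \<open>S\<close> of each of the three kinds of algebra is a closed Jordan-closed real
  subspace of a Banach algebra on which \<open>norm (a\<^sup>2) = (norm a)\<^sup>2\<close> and \<open>1 + a\<^sup>2\<close> is invertible. These
  properties alone suffice for the functional calculus: \<open>norm a\<close> or \<open>- norm a\<close> is in the spectrum of
  \<open>a\<close>, so the norm of \<open>p(a)\<close> is at most the supremum of \<open>\<bar>p\<bar>\<close> on the spectrum. They also make the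
  elements with spectrum in \<open>[0,\<infinity>)\<close> a convex cone that is invariant under \<open>y \<mapsto> dyd\<close> for
  invertible \<open>d\<close>.

  Conjugating \<open>\<delta> A\<^sup>\<beta> \<le> B\<close> with \<open>A\<close> to the power \<open>-\<beta>/2\<close> gives \<open>X \<ge> \<delta>\<close>. All five terms of the chain
  are conjugates of functions of \<open>X\<close>, so the theorem follows from the scalar inequalities
  \<open>2(u\<^sup>2 - 1)/(u\<^sup>2 + 1) \<le> 4(u - 1)/(u + 1) \<le> 2 ln u \<le> u - 1/u \<le> (u\<^sup>2 - 1/u\<^sup>2)/2\<close> for
  \<open>u = sqrt (t/\<delta>) \<ge> 1\<close>. Every term is odd under \<open>u \<mapsto> 1/u\<close>, hence the reversed chain for \<open>u \<le> 1\<close>.\<close>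

section \<open>Spectral radius of self-adjoint elements\<close>

text \<open>The obstacle is the lack of both complex scalars and a full product. \<open>S\<close> is
  closed only under commuting products and under \<open>a * b * a\<close>, and in the JC case
  inverses have to be found inside \<open>S\<close> as well. Hence the tools are those that stay in
  \<open>S\<close>: real polynomials in one element, norm limits of these (Neumann series among
  them), and sandwiches. The usual route to the spectral radius, analyticity of a complex resolvent,
  is replaced by a compactness argument with real parameters. The invertibility of
  \<open>1 + a^2\<close> is the real substitute for the reality of the spectrum: it makes every
  irreducible real quadratic in \<open>a\<close> invertible, so a real polynomial in
  \<open>a\<close> can fail to be invertible only through its real roots. In the abstract part
  complex numbers occur only as roots of such polynomials.

  The unit \<open>e\<close> may be a proper projection of the ambient algebra, so it acts as a unit
  on \<open>S\<close> only, and it may be 0.\<close>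

lemma sum_power_in_telescope:
  fixes e y :: "'a::real_normed_algebra"
  assumes "e * y = y" "e * e = e"
  shows "(e - y) * (\<Sum>i<n. power_in e y i) = e - power_in e y n"
proof -
  have e: "e * power_in e y i = power_in e y i" for i
    using assms by (cases i) (simp_all flip: mult.assoc)
  have "(e - y) * (\<Sum>i<n. power_in e y i) = (\<Sum>i<n. power_in e y i - power_in e y (Suc i))"
    by (simp add: sum_distrib_left left_diff_distrib e sum_subtractf)
  also have "\<dots> = power_in e y 0 - power_in e y n"
    by (rule sum_lessThan_telescope')
  finally show ?thesis by simp
qed

lemma power_in_commute:
  assumes "e * a = a" "a * e = a"
  shows "power_in e a n * a = a * power_in e a n"
  by (induction n) (simp_all add: assms mult.assoc)

lemma summable_power_in:
  fixes e y :: "'a::{real_normed_algebra,banach}"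
  assumes "norm y < 1" 
  shows "summable (power_in e y)"
proof -
  have "norm (power_in e y n) \<le> norm e * norm y ^ n" for n
  proof (induction n)
    case (Suc n)
    have "norm (power_in e y (Suc n)) \<le> norm y * norm (power_in e y n)"
      by (simp add: norm_mult_ineq)
    also have "\<dots> \<le> norm y * (norm e * norm y ^ n)"
      by (rule mult_left_mono[OF Suc]) simp
    finally show ?case by (simp add: algebra_simps)
  qed simp
  moreover have "summable (\<lambda>n. norm e * norm y ^ n)"
    using assms by (intro summable_mult summable_geometric) simp
  ultimately show ?thesis
    by (metis summable_comparison_test')
qed

text \<open>The ambient ring need not have a unit, so the geometric series is formed with
  \<open>power_in\<close>, which starts at \<open>e\<close>. The first equation is the limit of the
  telescoping sums; the second follows since every power commutes with \<open>y\<close>.\<close>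

lemma neumann_series:
  fixes e y :: "'a::{real_normed_algebra,banach}"
  assumes e: "e * y = y" "y * e = y" "e * e = e" and "norm y < 1"
  shows "(e - y) * suminf (power_in e y) = e" "suminf (power_in e y) * (e - y) = e"
proof -
  let ?b = "suminf (power_in e y)"
  have s: "summable (power_in e y)" by (rule summable_power_in[OF assms(4)])
  have comm: "power_in e y n * y = y * power_in e y n" for n
    by (rule power_in_commute[OF e(1,2)])
  have ep1: "e * power_in e y n = power_in e y n" for n
    by (cases n) (simp_all add: e flip: mult.assoc)
  have ep2: "power_in e y n * e = power_in e y n" for n
    by (induction n) (simp_all add: e mult.assoc)
  have "(\<lambda>n. (e - y) * (\<Sum>i<n. power_in e y i)) \<longlonglongrightarrow> (e - y) * ?b"
    by (intro tendsto_intros summable_LIMSEQ s)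
  moreover have "(\<lambda>n. (e - y) * (\<Sum>i<n. power_in e y i)) \<longlonglongrightarrow> e - 0"
    unfolding sum_power_in_telescope[OF e(1,3)] by (intro tendsto_intros summable_LIMSEQ_zero s)
  ultimately show *: "(e - y) * ?b = e"
    using LIMSEQ_unique by fastforce
  have "(e - y) * ?b = (\<Sum>n. (e - y) * power_in e y n)"
    by (rule suminf_mult[symmetric, OF s])
  also have "\<dots> = (\<Sum>n. power_in e y n * (e - y))"
    by (simp add: left_diff_distrib right_diff_distrib comm ep1 ep2)
  also have "\<dots> = ?b * (e - y)"
    by (rule suminf_mult2[symmetric, OF s])
  finally show "?b * (e - y) = e" unfolding * by (rule sym)
qed

text \<open>\<open>S\<close> is the self-adjoint part. The set \<open>U\<close> in which inverses are sought is the whole algebra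
  for (real) C*-algebras and \<open>S\<close> itself for JC-algebras.\<close>
locale jordan_banach =
  fixes U S :: "'a::{real_normed_algebra,banach} set" and e :: 'a
  assumes subspace_S: "subspace S"
    and closed_S: "closed S"
    and S_subset_U: "S \<subseteq> U"
    and unit_in: "e \<in> S"
    and unit_left: "a \<in> S \<Longrightarrow> e * a = a"
    and unit_right: "a \<in> S \<Longrightarrow> a * e = a"
    and square_in: "a \<in> S \<Longrightarrow> a * a \<in> S"
    and norm_square: "a \<in> S \<Longrightarrow> norm (a * a) = (norm a)\<^sup>2"
    and inverse_in: "a \<in> S \<Longrightarrow> b \<in> U \<Longrightarrow> a * b = e \<Longrightarrow> b * a = e \<Longrightarrow> b \<in> S"
begin

lemmas add_in = subspace_add[OF subspace_S]
lemmas diff_in = subspace_diff[OF subspace_S]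
lemmas scale_in = subspace_scale[OF subspace_S]
lemmas zero_in = subspace_0[OF subspace_S]

lemma unit_unit [simp]: "e * e = e"
  by (rule unit_left[OF unit_in])

text \<open>\<open>e * e = e\<close> and \<open>norm_square\<close> force \<open>norm e\<close> to
  be 0 or 1; the value 0 belongs to the zero algebra, which the locale admits.\<close>

lemma norm_unit_le: "norm e \<le> 1"
proof -
  have "norm e * 1 = norm e * norm e"
    using norm_square[OF unit_in] by (simp add: power2_eq_square)
  then show ?thesis by auto
qed

lemma jordan_in: "a \<in> S \<Longrightarrow> b \<in> S \<Longrightarrow> a * b + b * a \<in> S"
proof -
  assume ab: "a \<in> S" "b \<in> S"
  have "a * b + b * a = (a + b) * (a + b) - a * a - b * b"
    by (simp add: algebra_simps)
  then show ?thesis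
    by (simp add: ab add_in diff_in square_in)
qed

text \<open>For commuting factors the product is the Jordan product. This keeps all powers and
  polynomials of a single element in \<open>S\<close>.\<close>

lemma commute_in:
  assumes "a \<in> S" "b \<in> S" "a * b = b * a"
  shows "a * b \<in> S"
proof -
  have "a * b = (1/2) *\<^sub>R (a * b + b * a)"
    by (simp add: assms(3) flip: scaleR_2)
  then show ?thesis
    by (metis assms(1,2) jordan_in scale_in)
qed

text \<open>Twice the identity \<open>ABA = 2(A o B) o A - A^2 o B\<close>, with \<open>o\<close>
  the Jordan product. It keeps \<open>X\<close> and all conjugated terms in
  \<open>S\<close>.\<close>

lemma sandwich_in:
  assumes ab: "a \<in> S" "b \<in> S"
  shows "a * b * a \<in> S"
proof -
  let ?j = "a * b + b * a"
  have "(a * ?j + ?j * a) - ((a * a) * b + b * (a * a)) = 2 *\<^sub>R (a * b * a)"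
    by (simp add: algebra_simps scaleR_2)
  then have "a * b * a = (1/2) *\<^sub>R ((a * ?j + ?j * a) - ((a * a) * b + b * (a * a)))"
    by simp
  moreover have "(a * ?j + ?j * a) - ((a * a) * b + b * (a * a)) \<in> S"
    by (intro diff_in jordan_in ab square_in)
  ultimately show ?thesis by (metis scale_in)
qed

lemma power_in_mem: "a \<in> S \<Longrightarrow> power_in e a n \<in> S"
proof (induction n)
  case (Suc n)
  then show ?case
    using commute_in[of a "power_in e a n"] power_in_commute[of e a n]
    by (simp add: unit_left unit_right)
qed (simp add: unit_in)

section \<open>Inverses inside the self-adjoint part\<close>

definition inv_pair :: "'a \<Rightarrow> 'a \<Rightarrow> bool"
  where "inv_pair a b \<longleftrightarrow> a \<in> S \<and> b \<in> S \<and> a * b = e \<and> b * a = e"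

lemma invertible_in_iff: "a \<in> S \<Longrightarrow> invertible_in U e a \<longleftrightarrow> (\<exists>b. inv_pair a b)"
  unfolding invertible_in_def inv_pair_def using S_subset_U inverse_in by blast

lemma inv_pair_sym: "inv_pair a b \<Longrightarrow> inv_pair b a"
  by (simp add: inv_pair_def)

lemma inv_pair_unique:
  assumes "inv_pair a b" "inv_pair a c" shows "b = c"
  using assms unfolding inv_pair_def by (metis mult.assoc unit_left unit_right)

lemma inv_pair_commute:
  assumes ab: "inv_pair a b" and x: "x \<in> S" "x * a = a * x"
  shows "x * b = b * x"
proof -
  have "x * b = (b * a) * x * b"
    using ab x(1) by (simp add: inv_pair_def unit_left)
  also have "\<dots> = b * (x * (a * b))"
    by (metis x(2) mult.assoc)
  also have "\<dots> = b * x"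
    using ab x(1) by (simp add: inv_pair_def unit_right)
  finally show ?thesis .
qed

lemma inv_pair_scale:
  assumes "inv_pair a b" "r \<noteq> 0" shows "inv_pair (r *\<^sub>R a) (inverse r *\<^sub>R b)"
  using assms by (auto simp: inv_pair_def scale_in)

lemma inv_pair_mult:
  assumes "inv_pair a a'" "inv_pair b b'" "a * b = b * a"
  shows "inv_pair (a * b) (a' * b')"
proof -
  have 1: "b * a' = a' * b"
    using assms(2) by (intro inv_pair_commute[OF assms(1)]) (simp_all only: inv_pair_def assms(3))
  have 2: "a' * b' = b' * a'"
    using assms(1) 1 by (intro inv_pair_commute[OF assms(2)]) (simp_all only: inv_pair_def)
  have "a * b * (a' * b') = a * a' * (b * b')"
    by (metis 1 mult.assoc)
  also have "\<dots> = e" using assms(1,2) by (simp add: inv_pair_def)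
  finally have 3: "a * b * (a' * b') = e" .
  have "a' * b' * (a * b) = b' * (a' * a) * b"
    by (metis 2 mult.assoc)
  also have "\<dots> = e" using assms(1,2) by (simp add: inv_pair_def unit_right)
  finally have 4: "a' * b' * (a * b) = e" .
  show ?thesis
    using assms(1,2) 3 4 commute_in[OF _ _ assms(3)] commute_in[OF _ _ 2]
    unfolding inv_pair_def by blast
qed

text \<open>The inverse of \<open>a\<close> is \<open>b\<close> times the inverse of
  \<open>a * b\<close>. With \<open>a = b\<close> this passes from the invertibility of a square to
  that of its root.\<close>

lemma inv_pair_factor:
  assumes "inv_pair (a * b) c" "a \<in> S" "b \<in> S" "a * b = b * a"
  shows "inv_pair a (b * c)"
proof -
  have a: "a * c = c * a"
    by (rule inv_pair_commute[OF assms(1,2)]) (metis assms(4) mult.assoc)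
  have b: "b * c = c * b"
    by (rule inv_pair_commute[OF assms(1,3)]) (metis assms(4) mult.assoc)
  have 1: "a * (b * c) = e"
    using assms(1) unfolding inv_pair_def by (metis mult.assoc)
  moreover have "b * c * a = e"
    using assms(1) unfolding inv_pair_def by (metis a assms(4) mult.assoc)
  ultimately show ?thesis
    using assms(1,2,3) commute_in[OF _ _ b] unfolding inv_pair_def by blast
qed

lemma neumann_inv_pair:
  assumes "y \<in> S" "norm y < 1"
  shows "\<exists>b. inv_pair (e - y) b"
proof -
  have "(\<lambda>n. \<Sum>i<n. power_in e y i) \<longlonglongrightarrow> suminf (power_in e y)"
    by (intro summable_LIMSEQ summable_power_in assms)
  moreover have "(\<Sum>i<n. power_in e y i) \<in> S" for n
    by (intro subspace_sum subspace_S power_in_mem assms)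
  ultimately have "suminf (power_in e y) \<in> S"
    using closed_sequentially[OF closed_S, of "\<lambda>n. \<Sum>i<n. power_in e y i"] by blast
  moreover have "e - y \<in> S" by (intro diff_in unit_in assms)
  ultimately show ?thesis
    unfolding inv_pair_def
    using neumann_series[OF unit_left[OF assms(1)] unit_right[OF assms(1)] unit_unit assms(2)]
    by blast
qed

lemma neumann_scaled:
  assumes "y \<in> S" "norm y < r"
  shows "\<exists>b. inv_pair (r *\<^sub>R e - y) b"
proof -
  have r: "r > 0" using assms(2) norm_ge_zero[of y] by linarith
  have "\<exists>b. inv_pair (e - (1/r) *\<^sub>R y) b"
    using assms r by (intro neumann_inv_pair) (auto simp: scale_in)
  then obtain b where "inv_pair (e - (1/r) *\<^sub>R y) b" ..
  from inv_pair_scale[OF this, of r] r show ?thesis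
    by (auto simp: algebra_simps)
qed

text \<open>The resolvent identity \<open>R x - R k = R x * (g k - g x) * R k\<close> gives
  continuity as soon as \<open>R x\<close> is bounded near \<open>k\<close>.\<close>

lemma continuous_on_inv_pair:
  assumes g: "continuous_on K g" and R: "\<And>k. k \<in> K \<Longrightarrow> inv_pair (g k) (R k)"
  shows "continuous_on K R"
  unfolding continuous_on_def
proof
  fix k assume k: "k \<in> K"
  let ?n = "norm (R k)"
  have lim: "((\<lambda>x. norm (g k - g x)) \<longlongrightarrow> 0) (at k within K)"
    using g k by (auto simp: continuous_on_def intro!: tendsto_eq_intros)
  have bound: "norm (R x - R k) \<le> 2 * ?n * norm (g k - g x) * ?n"
    if "x \<in> K" and small: "norm (g k - g x) * ?n \<le> 1/2" for x
  proof -
    have eq: "R x - R k = R x * (g k - g x) * R k"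
    proof -
      have "R x * (g k - g x) * R k = R x * (g k * R k) - (R x * g x) * R k"
        by (simp add: algebra_simps)
      then show ?thesis
        using R[OF k] R[OF that(1)] unfolding inv_pair_def by (metis unit_left unit_right)
    qed
    have le: "norm (R x - R k) \<le> norm (R x) * norm (g k - g x) * ?n"
      unfolding eq by (meson mult_right_mono norm_ge_zero norm_mult_ineq order_trans)
    \<comment> \<open>The bound on \<open>R x\<close> comes from the identity itself: for
      \<open>g x\<close> close to \<open>g k\<close> the difference is at most half of
      \<open>norm (R x)\<close> and can be absorbed.\<close>
    have "norm (R x) \<le> ?n + norm (R x - R k)"
      by (metis add.commute diff_add_cancel norm_triangle_ineq)
    also have "norm (R x - R k) \<le> norm (R x) * (1/2)"
      using le mult_left_mono[OF small, of "norm (R x)"] by (simp add: mult.assoc)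
    finally have "norm (R x) \<le> 2 * ?n" by simp
    then have "norm (R x) * norm (g k - g x) * ?n \<le> 2 * ?n * norm (g k - g x) * ?n"
      by (intro mult_right_mono) auto
    with le show ?thesis by linarith
  qed
  have "((\<lambda>x. norm (g k - g x) * ?n) \<longlongrightarrow> 0 * ?n) (at k within K)"
    by (intro tendsto_mult lim tendsto_const)
  then have "\<forall>\<^sub>F x in at k within K. norm (g k - g x) * ?n < 1/2"
    by (rule order_tendstoD) simp
  then have ev: "\<forall>\<^sub>F x in at k within K. norm (R x - R k) \<le> 2 * ?n * norm (g k - g x) * ?n"
  proof (rule eventually_mono[OF eventually_conj])
    show "\<forall>\<^sub>F x in at k within K. x \<in> K" by (simp add: eventually_at_filter)
  qed (simp add: bound)
  have lim2: "((\<lambda>x. 2 * ?n * norm (g k - g x) * ?n) \<longlongrightarrow> 0) (at k within K)"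
    by (rule tendsto_eq_intros lim refl | simp)+
  have "((\<lambda>x. R x - R k) \<longlongrightarrow> 0) (at k within K)"
    by (rule Lim_null_comparison[OF ev lim2])
  then show "(R \<longlongrightarrow> R k) (at k within K)"
    by (rule LIM_zero_cancel)
qed

end

section \<open>Spectral radius by averaged resolvents\<close>

locale jordan_calculus = jordan_banach +
  assumes one_plus_square: "a \<in> S \<Longrightarrow> \<exists>b\<in>S. (e + a * a) * b = e \<and> b * (e + a * a) = e"
begin

text \<open>For \<open>c = cos \<theta>\<close> the relation \<open>avg_rel c x q\<close> says that \<open>q = (1 - c x) / (1 - 2 c x + x\<^sup>2)\<close>, the
  real form of the mean of \<open>1 / (1 - \<omega> x)\<close> and \<open>1 / (1 - \<omega>' x)\<close> for \<open>\<omega> = exp (i \<theta>)\<close> and its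
  conjugate \<open>\<omega>'\<close>. Averaging over \<open>\<plusminus>c\<close> replaces \<open>x\<close> by \<open>x\<^sup>2\<close> and \<open>\<theta>\<close> by \<open>2\<theta>\<close>.\<close>

definition quad :: "real \<Rightarrow> 'a \<Rightarrow> 'a"
  where "quad c x = e - (2 * c) *\<^sub>R x + x * x"

definition avg_rel :: "real \<Rightarrow> 'a \<Rightarrow> 'a \<Rightarrow> bool"
  where "avg_rel c x q \<longleftrightarrow> x \<in> S \<and> (\<exists>r. inv_pair (quad c x) r \<and> q = (e - c *\<^sub>R x) * r)"

text \<open>Real form of the statement that no nonreal \<open>s + it\<close> is in the spectrum: the
  two conjugate linear factors are multiplied out, and scaling by \<open>1/t\<close> reduces to
  \<open>e + w * w\<close>.\<close>

lemma shifted_square_invertible: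
  assumes x: "x \<in> S" and t: "t \<noteq> 0"
  shows "\<exists>r. inv_pair ((x - s *\<^sub>R e) * (x - s *\<^sub>R e) + t\<^sup>2 *\<^sub>R e) r"
proof -
  let ?w = "(1/t) *\<^sub>R (x - s *\<^sub>R e)"
  have w: "?w \<in> S" by (intro scale_in diff_in x unit_in)
  obtain b where "inv_pair (e + ?w * ?w) b"
    using one_plus_square[OF w] square_in[OF w] unit_in add_in unfolding inv_pair_def by blast
  from inv_pair_scale[OF this, of "t\<^sup>2"] t show ?thesis
    by (auto simp: scaleR_right_distrib power2_eq_square add.commute)
qed

text \<open>Completing the square gives \<open>(x - c)^2 + (1 - c^2)\<close>, which is invertible
  for \<open>\<bar>c\<bar> < 1\<close> without further conditions. At the end points
  \<open>c = 1\<close> and \<open>c = -1\<close> it is the square of \<open>e - x\<close> or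
  \<open>e + x\<close>, and there the two hypotheses enter.\<close>

lemma quad_invertible:
  assumes x: "x \<in> S" and c: "\<bar>c\<bar> \<le> 1"
    and "\<exists>r. inv_pair (e - x) r" "\<exists>r. inv_pair (e + x) r"
  shows "\<exists>r. inv_pair (quad c x) r"
proof (cases "\<bar>c\<bar> < 1")
  case True
  then have pos: "1 - c\<^sup>2 > 0" by (simp add: abs_square_less_1)
  have "quad c x = (x - c *\<^sub>R e) * (x - c *\<^sub>R e) + (sqrt (1 - c\<^sup>2))\<^sup>2 *\<^sub>R e"
    using pos x by (simp add: quad_def algebra_simps unit_left unit_right)
      (simp add: power2_eq_square flip: scaleR_add_left)
  then show ?thesis
    using shifted_square_invertible[OF x, of "sqrt (1 - c\<^sup>2)" c] pos by simp
next
  case False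
  have ex: "e * x = x" "x * e = x" using x by (simp_all add: unit_left unit_right)
  consider "c = 1" | "c = -1" using False c by linarith
  then show ?thesis
  proof cases
    case 1
    have "quad c x = (e - x) * (e - x)"
      by (simp add: quad_def 1 algebra_simps ex scaleR_2)
    then show ?thesis using assms(3) inv_pair_mult by metis
  next
    case 2
    have "quad c x = (e + x) * (e + x)"
      by (simp add: quad_def 2 algebra_simps ex scaleR_2)
    then show ?thesis using assms(4) inv_pair_mult by metis
  qed
qed

lemma avg_rel_double:
  assumes q: "avg_rel c x q1" "avg_rel (- c) x q2"
  shows "avg_rel (2 * c\<^sup>2 - 1) (x * x) ((1/2) *\<^sub>R (q1 + q2))"
proof -
  obtain r1 r2 where x: "x \<in> S" and r1: "inv_pair (quad c x) r1" and r2: "inv_pair (quad (- c) x) r2"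
    and q1: "q1 = (e - c *\<^sub>R x) * r1" and q2: "q2 = (e + c *\<^sub>R x) * r2"
    using q by (auto simp: avg_rel_def)
  have ex: "e * x = x" "x * e = x" "e * (x * y) = x * y" for y 
    using x by (simp_all add: unit_left unit_right flip: mult.assoc)
  let ?D1 = "quad c x" and ?D2 = "quad (- c) x"
  \<comment> \<open>\<open>(1 + x^2)^2 - 4 c^2 x^2 = 1 - 2 (2 c^2 - 1) x^2 + x^4\<close>, where
    \<open>2 c^2 - 1\<close> is the cosine of the doubled angle. The two fractions are then brought
    to this common denominator.\<close>
  have D: "?D1 * ?D2 = quad (2 * c\<^sup>2 - 1) (x * x)" "?D2 * ?D1 = quad (2 * c\<^sup>2 - 1) (x * x)"
    by (simp_all add: quad_def algebra_simps ex scaleR_add_left[symmetric] power2_eq_square)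
      (simp_all add: scaleR_2)
  have r: "inv_pair (quad (2 * c\<^sup>2 - 1) (x * x)) (r1 * r2)"
    using inv_pair_mult[OF r1 r2] D by simp
  have "inv_pair (quad (2 * c\<^sup>2 - 1) (x * x)) (r2 * r1)"
    using inv_pair_mult[OF r2 r1] D by simp
  then have comm: "r1 * r2 = r2 * r1" using inv_pair_unique r by blast
  have S: "r1 \<in> S" "r2 \<in> S" using r1 r2 by (auto simp: inv_pair_def)
  have 1: "r1 = ?D2 * (r1 * r2)"
  proof -
    have "?D2 * r2 = e" using r2 by (simp add: inv_pair_def)
    then have "?D2 * (r2 * r1) = r1" using unit_left[OF S(1)] by (simp flip: mult.assoc)
    then show ?thesis by (simp add: comm)
  qed
  have 2: "r2 = ?D1 * (r1 * r2)"
  proof -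
    have "?D1 * r1 = e" using r1 by (simp add: inv_pair_def)
    then show ?thesis using unit_left[OF S(2)] by (simp flip: mult.assoc)
  qed
  have "q1 + q2 = ((e - c *\<^sub>R x) * ?D2 + (e + c *\<^sub>R x) * ?D1) * (r1 * r2)"
    by (simp only: q1 q2 distrib_right mult.assoc 1[symmetric] 2[symmetric])
  also have "(e - c *\<^sub>R x) * ?D2 + (e + c *\<^sub>R x) * ?D1 = 2 *\<^sub>R (e - (2 * c\<^sup>2 - 1) *\<^sub>R (x * x))"
    by (simp add: quad_def algebra_simps ex scaleR_2 power2_eq_square)
      (simp add: scaleR_add_left[symmetric])
  finally have "(1/2) *\<^sub>R (q1 + q2) = (e - (2 * c\<^sup>2 - 1) *\<^sub>R (x * x)) * (r1 * r2)"
    by simp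
  then show ?thesis
    unfolding avg_rel_def using r square_in[OF x] by blast
qed

primrec iter_square :: "'a \<Rightarrow> nat \<Rightarrow> 'a" where
  "iter_square x 0 = x"
| "iter_square x (Suc k) = iter_square x k * iter_square x k"

lemma iter_square_in: "x \<in> S \<Longrightarrow> iter_square x k \<in> S"
  by (induction k) (auto intro: square_in)

lemma norm_iter_square: "x \<in> S \<Longrightarrow> norm (iter_square x k) = norm x ^ (2 ^ k)"
  by (induction k) (simp_all add: norm_square iter_square_in mult.commute flip: power_mult)

text \<open>The bound does not grow with \<open>k\<close>: the new difference is the mean of two old
  ones. They belong to other values of \<open>c\<close>, so the base case must hold for all
  \<open>c\<close> in \<open>[-1, 1]\<close> with the same \<open>\<epsilon>\<close>.\<close>

lemma avg_rel_iterate: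
  assumes base: "\<And>c. \<bar>c\<bar> \<le> 1 \<Longrightarrow> \<exists>q q'. avg_rel c x q \<and> avg_rel c x' q' \<and> norm (q - q') \<le> \<epsilon>"
    and "\<bar>c\<bar> \<le> 1"
  shows "\<exists>q q'. avg_rel c (iter_square x k) q \<and> avg_rel c (iter_square x' k) q' \<and> norm (q - q') \<le> \<epsilon>"
  using assms(2)
proof (induction k arbitrary: c)
  case 0
  then show ?case using base by simp
next
  case (Suc k)
  \<comment> \<open>Half-angle formula, the inverse of \<open>c = 2 d^2 - 1\<close>.\<close>
  define d where "d = sqrt ((1 + c) / 2)"
  have d: "\<bar>d\<bar> \<le> 1" "\<bar>- d\<bar> \<le> 1" "c = 2 * d\<^sup>2 - 1"
    using Suc.prems by (auto simp: d_def field_simps)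
  obtain q1 q1' where 1: "avg_rel d (iter_square x k) q1" "avg_rel d (iter_square x' k) q1'"
    "norm (q1 - q1') \<le> \<epsilon>" using Suc.IH[OF d(1)] by blast
  obtain q2 q2' where 2: "avg_rel (- d) (iter_square x k) q2" "avg_rel (- d) (iter_square x' k) q2'"
    "norm (q2 - q2') \<le> \<epsilon>" using Suc.IH[OF d(2)] by blast
  have "norm ((1/2) *\<^sub>R (q1 + q2) - (1/2) *\<^sub>R (q1' + q2')) = norm ((q1 - q1') + (q2 - q2')) / 2"
    by (simp add: algebra_simps flip: scaleR_diff_right scaleR_add_right)
  also have "\<dots> \<le> \<epsilon>" using 1(3) 2(3) norm_triangle_ineq[of "q1 - q1'" "q2 - q2'"] by simp
  finally show ?case
    using avg_rel_double[OF 1(1) 2(1)] avg_rel_double[OF 1(2) 2(2)] unfolding d(3) iter_square.simps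
    by blast
qed

text \<open>Rickart's argument: if \<open>1 - a\<close> and \<open>1 + a\<close> were invertible, the averaged resolvents of \<open>sa\<close> would
  be uniformly continuous in \<open>(c, s)\<close>, so for some \<open>s < 1\<close> the inverses of \<open>1 - a\<^sup>n\<close> and
  \<open>1 - (sa)\<^sup>n\<close> would stay close for all \<open>n = 2\<^sup>k\<close>. The second one tends to \<open>1\<close>, while
  \<open>norm (a\<^sup>n) = 1\<close>.\<close>
lemma unit_norm_not_invertible:
  assumes a: "a \<in> S" "norm a = 1" and inv: "inv_pair (e - a) u" "inv_pair (e + a) v"
  shows False
proof -
  define K :: "(real \<times> real) set" where "K = {-1..1} \<times> {0..1}"
  have ex: "\<exists>r. inv_pair (quad (fst k) (snd k *\<^sub>R a)) r" if "k \<in> K" for k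
  proof (rule quad_invertible)
    let ?s = "snd k"
    show "?s *\<^sub>R a \<in> S" using a by (simp add: scale_in)
    show "\<bar>fst k\<bar> \<le> 1" using that by (auto simp: K_def)
    show "\<exists>r. inv_pair (e - ?s *\<^sub>R a) r" "\<exists>r. inv_pair (e + ?s *\<^sub>R a) r"
    proof -
      have "0 \<le> ?s" "?s \<le> 1" using that by (auto simp: K_def)
      then consider "?s = 1" | "\<bar>?s\<bar> < 1" by linarith
      then have "(\<exists>r. inv_pair (e - ?s *\<^sub>R a) r) \<and> (\<exists>r. inv_pair (e + ?s *\<^sub>R a) r)"
      proof cases
        case 1
        then show ?thesis using inv by auto
      next
        case 2
        have "\<exists>b. inv_pair (e - t *\<^sub>R a) b" if "\<bar>t\<bar> < 1" for t
          using that a by (intro neumann_inv_pair scale_in) auto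
        from this[of ?s] this[of "- ?s"] 2 show ?thesis by simp
      qed
      then show "\<exists>r. inv_pair (e - ?s *\<^sub>R a) r" "\<exists>r. inv_pair (e + ?s *\<^sub>R a) r" by auto
    qed
  qed
  then obtain R where R: "\<And>k. k \<in> K \<Longrightarrow> inv_pair (quad (fst k) (snd k *\<^sub>R a)) (R k)"
    by metis
  have cont: "continuous_on K (\<lambda>k. quad (fst k) (snd k *\<^sub>R a))"
    unfolding quad_def by (intro continuous_intros)
  define F where "F k = (e - fst k *\<^sub>R (snd k *\<^sub>R a)) * R k" for k
  have F: "continuous_on K F"
    unfolding F_def by (intro continuous_intros continuous_on_inv_pair[OF cont R])
  have "compact K" unfolding K_def by (intro compact_Times) auto
  then have "uniformly_continuous_on K F"
    by (rule compact_uniformly_continuous[OF F])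
  \<comment> \<open>The tolerance 1/8 is fixed by the end of the proof: together with an error of at
    most 1/8 for \<open>q'\<close> it gives \<open>norm (q - e) <= 1/4\<close>, whence
    \<open>norm x = norm ((q - e) * (e - x)) <= 1/2\<close>. The later bound 1/16 on
    \<open>norm x'\<close> gives \<open>norm q' <= 16/15\<close>, so that error is in fact at most
    1/15.\<close>
  then obtain d where d: "d > 0" "\<And>k k'. k \<in> K \<Longrightarrow> k' \<in> K \<Longrightarrow> dist k' k < d \<Longrightarrow> dist (F k') (F k) < 1/8"
    unfolding uniformly_continuous_on_def by (metis zero_less_divide_1_iff zero_less_numeral)
  define s where "s = max 0 (1 - d/2)"
  have s: "0 \<le> s" "s < 1" "1 - s < d" using d(1) by (auto simp: s_def)
  have base: "\<exists>q q'. avg_rel c a q \<and> avg_rel c (s *\<^sub>R a) q' \<and> norm (q - q') \<le> 1/8"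
    if c: "\<bar>c\<bar> \<le> 1" for c
  proof (intro exI conjI)
    have K: "(c, 1) \<in> K" "(c, s) \<in> K" using c s by (auto simp: K_def)
    show "avg_rel c a (F (c, 1))" "avg_rel c (s *\<^sub>R a) (F (c, s))"
      using R[OF K(1)] R[OF K(2)] a by (auto simp: avg_rel_def F_def scale_in)
    have "dist (c, 1) (c, s) < d" using s by (simp add: dist_Pair_Pair dist_real_def)
    from d(2)[OF K(2,1) this] show "norm (F (c, 1) - F (c, s)) \<le> 1/8"
      by (simp add: dist_norm)
  qed
  have "(\<lambda>k. s ^ (2 ^ k)) \<longlonglongrightarrow> 0"
  proof (rule filterlim_compose[OF LIMSEQ_power_zero])
    show "norm s < 1" using s by simp
    show "filterlim (\<lambda>k::nat. 2 ^ k :: nat) sequentially sequentially"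
      by (rule filterlim_subseq) (simp add: strict_mono_def)
  qed
  then have "\<forall>\<^sub>F k in sequentially. s ^ (2 ^ k) < 1/16"
    by (rule order_tendstoD) simp
  then obtain k where k: "s ^ (2 ^ k) < 1/16"
    by (auto simp: eventually_sequentially)
  define x x' where "x = iter_square a k" and "x' = iter_square (s *\<^sub>R a) k"
  have x: "x \<in> S" "norm x = 1" using a by (auto simp: x_def iter_square_in norm_iter_square)
  have x': "x' \<in> S" "norm x' < 1/16"
    using a s k by (auto simp: x'_def iter_square_in norm_iter_square scale_in)
  obtain q q' where q: "avg_rel 1 x q" "avg_rel 1 x' q'" "norm (q - q') \<le> 1/8"
    using avg_rel_iterate[of a "s *\<^sub>R a" "1/8" 1 k, OF base] unfolding x_def x'_def by auto
  \<comment> \<open>At \<open>c = 1\<close> the denominator is \<open>(e - y)^2\<close>, so the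
    averaged resolvent is the ordinary inverse of \<open>e - y\<close>.\<close>
  have inv1: "inv_pair (e - y) z" if "avg_rel 1 y z" for y z
  proof -
    from that obtain r where y: "y \<in> S" and r: "inv_pair (quad 1 y) r" "z = (e - y) * r"
      by (auto simp: avg_rel_def)
    have "quad 1 y = (e - y) * (e - y)"
      using y by (simp add: quad_def algebra_simps scaleR_2 unit_left unit_right)
    then show ?thesis
      using r y inv_pair_factor[of "e - y" "e - y" r] by (simp add: diff_in unit_in)
  qed
  have qx: "q - e = q * x" "q' - e = q' * x'" "(q - e) * (e - x) = x"
    using inv1[OF q(1)] inv1[OF q(2)] x x'
    by (auto simp: inv_pair_def algebra_simps unit_left unit_right)
  have "norm q' \<le> norm e + norm (q' - e)"
    by (metis add.commute diff_add_cancel norm_triangle_ineq)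
  moreover have n: "norm (q' - e) \<le> norm q' * norm x'" by (simp add: qx norm_mult_ineq)
  moreover have n2: "norm q' * norm x' \<le> norm q' * (1/16)"
    by (rule mult_left_mono) (use x' in auto)
  ultimately have "norm (q' - e) \<le> 1/8" using norm_unit_le by linarith
  then have qe: "norm (q - e) \<le> 1/4" using q(3) norm_triangle_ineq[of "q - q'" "q' - e"] by simp
  have "norm (e - x) \<le> 2" using norm_triangle_ineq4[of e x] x norm_unit_le by simp
  have "1 = norm ((q - e) * (e - x))" using qx x by simp
  also have "\<dots> \<le> norm (q - e) * norm (e - x)" by (rule norm_mult_ineq)
  also have "\<dots> \<le> (1/4) * 2" using qe \<open>norm (e - x) \<le> 2\<close> by (intro mult_mono) auto
  finally show False by simp
qed

end

section \<open>Functional calculus and positive cone\<close>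

lemma poly_in_altdef:
  assumes "degree p \<le> n"
  shows "poly_in e p a = (\<Sum>i\<le>n. coeff p i *\<^sub>R power_in e a i)"
  unfolding poly_in_def
  using assms by (intro sum.mono_neutral_left) (auto simp: coeff_eq_0)

lemma poly_in_0 [simp]: "poly_in e 0 a = 0"
  by (simp add: poly_in_def)

lemma poly_in_pCons: "poly_in e (pCons c p) a = c *\<^sub>R e + a * poly_in e p a"
proof -
  have "poly_in e (pCons c p) a = (\<Sum>i\<le>Suc (degree p). coeff (pCons c p) i *\<^sub>R power_in e a i)"
    by (rule poly_in_altdef) (simp add: degree_pCons_le)
  also have "\<dots> = c *\<^sub>R e + (\<Sum>i\<le>degree p. coeff p i *\<^sub>R (a * power_in e a i))"
    by (subst sum.atMost_Suc_shift) simp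
  also have "(\<Sum>i\<le>degree p. coeff p i *\<^sub>R (a * power_in e a i)) = a * poly_in e p a"
    by (simp add: poly_in_def sum_distrib_left)
  finally show ?thesis .
qed

lemma poly_in_add: "poly_in e (p + q) a = poly_in e p a + poly_in e q a"
proof -
  define n where "n = max (degree p) (degree q)"
  have "degree (p + q) \<le> n" "degree p \<le> n" "degree q \<le> n"
    by (auto simp: n_def degree_add_le_max)
  then show ?thesis
    by (simp add: poly_in_altdef[of _ n] scaleR_add_left sum.distrib)
qed

lemma poly_in_smult: "poly_in e (smult c p) a = c *\<^sub>R poly_in e p a"
  by (simp add: poly_in_altdef[of _ "degree p"] degree_smult_le scaleR_sum_right)

lemma poly_in_diff: "poly_in e (p - q) a = poly_in e p a - poly_in e q a"
  using poly_in_add[of e p "smult (-1) q" a] poly_in_smult[of e "-1" q a] by simp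

lemma map_poly_of_real_add:
  "map_poly complex_of_real (p + q) = map_poly complex_of_real p + map_poly complex_of_real q"
  by (rule poly_eqI) (simp add: coeff_map_poly)

lemma map_poly_of_real_mult:
  "map_poly complex_of_real (p * q) = map_poly complex_of_real p * map_poly complex_of_real q"
  by (induction p) (simp_all add: map_poly_of_real_add map_poly_pCons map_poly_smult)

lemma poly_map_poly_of_real:
  "poly (map_poly complex_of_real p) (complex_of_real x) = complex_of_real (poly p x)"
  by (induction p) (simp_all add: map_poly_pCons)

text \<open>Take a complex root \<open>z\<close>. If it is not real, the remainder of
  \<open>q\<close> modulo \<open>(X - z)(X - cnj z)\<close> is a real polynomial of degree at most 1
  that vanishes at \<open>z\<close>, hence it is 0.\<close>

lemma real_poly_factor:
  fixes q :: "real poly"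
  assumes "degree q > 0"
  obtains s r where "q = [:- s, 1:] * r"
  | s t r where "t \<noteq> 0" "q = [:s\<^sup>2 + t\<^sup>2, - 2 * s, 1:] * r"
proof -
  let ?h = "map_poly complex_of_real"
  have "degree (?h q) > 0" using assms by (simp add: degree_map_poly)
  then obtain z where z: "poly (?h q) z = 0"
    using fundamental_theorem_of_algebra_alt[of "?h q"] by (metis degree_pCons_0 less_irrefl)
  show ?thesis
  proof (cases "Im z = 0")
    case True
    then have "z = complex_of_real (Re z)" by (simp add: complex_eq_iff)
    then have "poly q (Re z) = 0"
      using z poly_map_poly_of_real[of q "Re z"] by simp
    then show ?thesis using that(1) by (auto simp: poly_eq_0_iff_dvd elim!: dvdE)
  next
    case False
    let ?d = "[:(Re z)\<^sup>2 + (Im z)\<^sup>2, - 2 * Re z, 1:]"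
    let ?m = "q mod ?d"
    have dz: "poly (?h ?d) z = 0"
      by (simp add: map_poly_pCons complex_eq_iff power2_eq_square algebra_simps)
    have "?h q = ?h ?d * ?h (q div ?d) + ?h ?m"
      unfolding map_poly_of_real_mult[symmetric] map_poly_of_real_add[symmetric] mult_div_mod_eq ..
    then have mz: "poly (?h ?m) z = 0" using z dz by simp
    have "degree ?m < 2"
      using degree_mod_less[of ?d q] by auto
    then have m: "?m = [:coeff ?m 0, coeff ?m 1:]"
      by (intro poly_eqI) (auto simp: coeff_pCons coeff_eq_0 split: nat.splits)
    define u v where "u = coeff ?m 0" and "v = coeff ?m 1"
    have m: "?m = [:u, v:]" using m by (simp add: u_def v_def)
    have "v * Im z = 0" "u + v * Re z = 0"
      using mz unfolding m by (simp_all add: complex_eq_iff map_poly_pCons mult.commute)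
    then have "?m = 0" using False m by simp
    then have "q = ?d * (q div ?d)" by (metis add.right_neutral mult_div_mod_eq)
    then show ?thesis using that(2) False by blast
  qed
qed

context jordan_calculus
begin

abbreviation spec :: "'a \<Rightarrow> real set"
  where "spec a \<equiv> real_spectrum U e a"

section \<open>Spectrum and the norm of polynomials\<close>

lemma spec_iff: "a \<in> S \<Longrightarrow> t \<in> spec a \<longleftrightarrow> (\<nexists>b. inv_pair (a - t *\<^sub>R e) b)"
  unfolding real_spectrum_def by (simp add: invertible_in_iff diff_in scale_in unit_in)

lemma inv_pair_minus: "inv_pair a b \<Longrightarrow> inv_pair (- a) (- b)"
  using inv_pair_scale[of a b "-1"] by simp

lemma spec_bound:
  assumes a: "a \<in> S" and t: "t \<in> spec a"
  shows "\<bar>t\<bar> \<le> norm a"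
proof (rule ccontr)
  assume "\<not> ?thesis"
  then consider "norm a < t" | "norm (- a) < - t" by force
  then have "\<exists>b. inv_pair (a - t *\<^sub>R e) b"
  proof cases
    case 1
    then obtain b where "inv_pair (t *\<^sub>R e - a) b" using neumann_scaled[OF a] by blast
    then show ?thesis using inv_pair_minus by fastforce
  next
    case 2
    have "- a \<in> S" using scale_in[OF a, of "-1"] by simp
    from neumann_scaled[OF this 2] show ?thesis by (simp add: add.commute)
  qed
  with t show False using spec_iff[OF a] by blast
qed

lemma norm_in_spec:
  assumes a: "a \<in> S" "a \<noteq> 0"
  shows "norm a \<in> spec a \<or> - norm a \<in> spec a"
proof (rule ccontr)
  assume "\<not> ?thesis"
  then obtain u v where uv: "inv_pair (a - norm a *\<^sub>R e) u" "inv_pair (a + norm a *\<^sub>R e) v"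
    using spec_iff[OF a(1)] by (metis diff_minus_eq_add scaleR_minus_left)
  let ?n = "norm a"
  have n: "?n \<noteq> 0" using a by simp
  define x where "x = (1 / ?n) *\<^sub>R a"
  have "inv_pair ((- 1 / ?n) *\<^sub>R (a - ?n *\<^sub>R e)) (inverse (- 1 / ?n) *\<^sub>R u)"
    using n by (intro inv_pair_scale uv) simp
  moreover have "(- 1 / ?n) *\<^sub>R (a - ?n *\<^sub>R e) = e - x"
    using n by (simp add: x_def algebra_simps)
  moreover have "inv_pair ((1 / ?n) *\<^sub>R (a + ?n *\<^sub>R e)) (inverse (1 / ?n) *\<^sub>R v)"
    using n by (intro inv_pair_scale uv) simp
  moreover have "(1 / ?n) *\<^sub>R (a + ?n *\<^sub>R e) = e + x"
    using n by (simp add: x_def algebra_simps)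
  moreover have "x \<in> S" "norm x = 1"
    using a n by (auto simp: x_def scale_in)
  ultimately show False using unit_norm_not_invertible by metis
qed

text \<open>In the zero algebra every element is invertible and all spectra are empty, hence the
  condition on \<open>e\<close>.\<close>

lemma spec_nonempty:
  assumes "a \<in> S" "e \<noteq> 0"
  shows "spec a \<noteq> {}"
proof (cases "a = 0")
  case True
  have "0 \<in> spec a"
    using assms spec_iff[OF assms(1), of 0] True by (auto simp: inv_pair_def)
  then show ?thesis by blast
next
  case False
  then show ?thesis using norm_in_spec[OF assms(1)] by blast
qed

lemma poly_in_mem: "a \<in> S \<Longrightarrow> poly_in e p a \<in> S"
  unfolding poly_in_def by (intro subspace_sum subspace_S scale_in power_in_mem)

lemma poly_in_mult:
  assumes a: "a \<in> S"
  shows "poly_in e (p * q) a = poly_in e p a * poly_in e q a"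
proof (induction p)
  case (pCons c p)
  then show ?case
    using unit_left[OF poly_in_mem[OF a, of q]]
    by (simp add: poly_in_pCons poly_in_add poly_in_smult distrib_right mult.assoc)
qed simp

lemma poly_in_commute:
  assumes a: "a \<in> S"
  shows "poly_in e p a * poly_in e q a = poly_in e q a * poly_in e p a"
  by (metis a mult.commute poly_in_mult)

lemma poly_in_const: "poly_in e [:c:] a = c *\<^sub>R e"
  by (simp add: poly_in_pCons)

lemma poly_in_linear: "a \<in> S \<Longrightarrow> poly_in e [:c, 1:] a = a + c *\<^sub>R e"
  by (simp add: poly_in_pCons unit_right add.commute)

text \<open>One half of the spectral mapping theorem, by splitting off irreducible real factors. A
  linear factor is invertible because its root lies off the spectrum, a quadratic one always. The
  zero polynomial is excluded separately, since an empty spectrum would admit it.\<close>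

lemma poly_in_invertible:
  assumes a: "a \<in> S" and "q \<noteq> 0" and "\<And>t. t \<in> spec a \<Longrightarrow> poly q t \<noteq> 0"
  shows "\<exists>b. inv_pair (poly_in e q a) b"
  using assms(2,3)
proof (induction "degree q" arbitrary: q rule: less_induct)
  case less
  have product: "\<exists>b. inv_pair (poly_in e q a) b"
    if q: "q = d * r" and d: "degree d > 0" and "\<exists>b. inv_pair (poly_in e d a) b" for d r
  proof -
    have "degree r < degree q"
      using less.prems(1) d unfolding q by (auto simp: degree_mult_eq)
    then have "\<exists>b. inv_pair (poly_in e r a) b"
      using less.prems by (intro less.hyps) (auto simp: q)
    then show ?thesis
      unfolding q poly_in_mult[OF a]
      using that(3) inv_pair_mult poly_in_commute[OF a] by blast
  qed
  show ?case
  proof (cases "degree q = 0")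
    case True
    then obtain c where c: "q = [:c:]" "c \<noteq> 0" using less.prems(1) by (metis degree_eq_zeroE pCons_eq_0_iff)
    have "inv_pair (c *\<^sub>R e) (inverse c *\<^sub>R e)"
      by (rule inv_pair_scale) (use c in \<open>simp_all add: inv_pair_def unit_in\<close>)
    then show ?thesis unfolding c poly_in_const by blast
  next
    case False
    then have "degree q > 0" by simp
    then show ?thesis
    proof (cases rule: real_poly_factor)
      case (1 s r)
      have "s \<notin> spec a" using less.prems(2)[of s] 1 by auto
      then have "\<exists>b. inv_pair (poly_in e [:- s, 1:] a) b"
        using spec_iff[OF a] by (simp add: poly_in_linear[OF a])
      then show ?thesis using product[OF 1] by simp
    next
      case (2 s t r)
      have "poly_in e [:s\<^sup>2 + t\<^sup>2, - 2 * s, 1:] a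
          = (a - s *\<^sub>R e) * (a - s *\<^sub>R e) + t\<^sup>2 *\<^sub>R e"
        using unit_left[OF a] unit_right[OF a]
        by (simp add: poly_in_pCons algebra_simps power2_eq_square flip: scaleR_add_left)
      then have "\<exists>b. inv_pair (poly_in e [:s\<^sup>2 + t\<^sup>2, - 2 * s, 1:] a) b"
        using shifted_square_invertible[OF a 2(1)] by simp
      then show ?thesis using product[OF 2(2)] by simp
    qed
  qed
qed

text \<open>The norm of \<open>b = p(a)\<close> is attained as \<open>\<bar>r\<bar>\<close> with
  \<open>r\<close> in the spectrum of \<open>b\<close>. If it exceeded \<open>M\<close>, then
  \<open>p - r\<close> would have no zero on the spectrum of \<open>a\<close>, and
  \<open>b - r\<close> would be invertible.\<close>

lemma norm_poly_in_le:
  assumes a: "a \<in> S" and M: "0 \<le> M" "\<And>t. t \<in> spec a \<Longrightarrow> \<bar>poly p t\<bar> \<le> M"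
  shows "norm (poly_in e p a) \<le> M"
proof (rule ccontr)
  let ?b = "poly_in e p a"
  assume *: "\<not> ?thesis"
  have b: "?b \<in> S" "?b \<noteq> 0" using poly_in_mem[OF a] * M(1) by auto
  then have "e \<noteq> 0" using unit_left by force
  obtain r where r: "\<bar>r\<bar> = norm ?b" "r \<in> spec ?b"
    using norm_in_spec[OF b] by force
  have ne: "poly (p - [:r:]) t \<noteq> 0" if "t \<in> spec a" for t
    using M(2)[OF that] * r(1) by auto
  moreover have "p - [:r:] \<noteq> 0"
    using ne spec_nonempty[OF a \<open>e \<noteq> 0\<close>] by force
  ultimately obtain c where "inv_pair (poly_in e (p - [:r:]) a) c"
    using poly_in_invertible[OF a] by blast
  then show False
    using r(2) spec_iff[OF b(1)] by (auto simp: poly_in_diff poly_in_const)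
qed

text \<open>A relational form of \<open>cfc\<close>, so that rules can be composed without first
  proving that the description in \<open>cfc\<close> denotes. Boundedness of \<open>f\<close> is
  included because uniform limits can be multiplied only if the limit functions are bounded.\<close>

definition has_cfc :: "'a \<Rightarrow> (real \<Rightarrow> real) \<Rightarrow> 'a \<Rightarrow> bool"
  where "has_cfc a f b \<longleftrightarrow> bounded (f ` spec a) \<and>
    (\<exists>p. uniform_limit (spec a) (\<lambda>n. poly (p n)) f sequentially \<and>
      (\<lambda>n. poly_in e (p n) a) \<longlonglongrightarrow> b)"

lemma uniform_limit_poly_in_zero:
  assumes a: "a \<in> S" and u: "uniform_limit (spec a) (\<lambda>n. poly (p n)) (\<lambda>_. 0) sequentially"
  shows "(\<lambda>n. poly_in e (p n) a) \<longlonglongrightarrow> 0"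
proof (rule LIMSEQ_I)
  fix r :: real assume r: "r > 0"
  then obtain N where N: "\<And>n t. n \<ge> N \<Longrightarrow> t \<in> spec a \<Longrightarrow> \<bar>poly (p n) t\<bar> < r / 2"
    using u unfolding uniform_limit_sequentially_iff
    by (metis dist_real_def diff_zero half_gt_zero)
  have "norm (poly_in e (p n) a) \<le> r / 2" if "n \<ge> N" for n
    using r N[OF that] by (intro norm_poly_in_le[OF a]) (auto intro: less_imp_le)
  then show "\<exists>N. \<forall>n\<ge>N. norm (poly_in e (p n) a - 0) < r"
    using r by (metis diff_zero field_sum_of_halves less_add_same_cancel1 half_gt_zero order_le_less_trans)
qed

text \<open>This makes the description in \<open>cfc\<close> well defined: the limit depends on the
  values of \<open>f\<close> on the spectrum only, not on the approximating polynomials.\<close>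

lemma poly_approx_unique:
  assumes a: "a \<in> S"
    and p: "uniform_limit (spec a) (\<lambda>n. poly (p n)) f sequentially" "(\<lambda>n. poly_in e (p n) a) \<longlonglongrightarrow> b"
    and q: "uniform_limit (spec a) (\<lambda>n. poly (q n)) f sequentially" "(\<lambda>n. poly_in e (q n) a) \<longlonglongrightarrow> c"
  shows "b = c"
proof -
  have "uniform_limit (spec a) (\<lambda>n. poly (p n - q n)) (\<lambda>_. 0) sequentially"
    using uniform_limit_minus[OF p(1) q(1)] by (simp add: poly_diff[abs_def])
  from uniform_limit_poly_in_zero[OF a this]
  have "(\<lambda>n. poly_in e (p n) a - poly_in e (q n) a) \<longlonglongrightarrow> 0"
    by (simp add: poly_in_diff)
  moreover have "(\<lambda>n. poly_in e (p n) a - poly_in e (q n) a) \<longlonglongrightarrow> b - c"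
    by (intro tendsto_diff p q)
  ultimately show ?thesis using LIMSEQ_unique by fastforce
qed

lemma cfc_eqI:
  assumes "a \<in> S" "has_cfc a f b"
  shows "cfc U e f a = b"
proof -
  obtain p where p: "uniform_limit (spec a) (\<lambda>n. poly (p n)) f sequentially"
    "(\<lambda>n. poly_in e (p n) a) \<longlonglongrightarrow> b"
    using assms(2) by (auto simp: has_cfc_def)
  show ?thesis
    unfolding cfc_def
  proof (rule the_equality)
    show "\<exists>p. uniform_limit (spec a) (\<lambda>n. poly (p n)) f sequentially \<and> (\<lambda>n. poly_in e (p n) a) \<longlonglongrightarrow> b"
      using p by blast
  next
    fix c
    assume "\<exists>q. uniform_limit (spec a) (\<lambda>n. poly (q n)) f sequentially \<and> (\<lambda>n. poly_in e (q n) a) \<longlonglongrightarrow> c"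
    then show "c = b" using poly_approx_unique[OF assms(1) _ _ p] by blast
  qed
qed

lemma has_cfc_unique: "a \<in> S \<Longrightarrow> has_cfc a f b \<Longrightarrow> has_cfc a f c \<Longrightarrow> b = c"
  using cfc_eqI by blast

lemma has_cfc_in:
  assumes "a \<in> S" "has_cfc a f b" shows "b \<in> S"
proof -
  obtain p where p: "(\<lambda>n. poly_in e (p n) a) \<longlonglongrightarrow> b"
    using assms(2) by (auto simp: has_cfc_def)
  then show ?thesis
    using closed_sequentially[OF closed_S, of "\<lambda>n. poly_in e (p n) a"] poly_in_mem[OF assms(1)] by blast
qed

lemma has_cfc_cong:
  assumes "has_cfc a f b" "\<And>t. t \<in> spec a \<Longrightarrow> f t = g t"
  shows "has_cfc a g b"
proof -
  have "f ` spec a = g ` spec a" using assms(2) by (rule image_cong[OF refl])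
  moreover have "uniform_limit (spec a) P f sequentially = uniform_limit (spec a) P g sequentially" for P
    by (rule uniform_limit_cong') (use assms(2) in auto)
  ultimately show ?thesis using assms(1) by (simp add: has_cfc_def)
qed

lemma has_cfc_poly:
  assumes "a \<in> S" shows "has_cfc a (poly p) (poly_in e p a)"
proof -
  have "spec a \<subseteq> cball 0 (norm a)" using spec_bound[OF assms] by auto
  then have "poly p ` spec a \<subseteq> poly p ` cball 0 (norm a)" by blast
  moreover have "bounded (poly p ` cball 0 (norm a))"
    by (intro compact_imp_bounded compact_continuous_image continuous_intros) simp
  ultimately have "bounded (poly p ` spec a)" using bounded_subset by blast
  then show ?thesis unfolding has_cfc_def
    by (intro conjI exI[of _ "\<lambda>_. p"]) (auto simp: uniform_limit_const)
qed

lemma has_cfc_id: "a \<in> S \<Longrightarrow> has_cfc a (\<lambda>t. t) a"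
  using has_cfc_poly[of a "[:0, 1:]"] by (auto simp: poly_in_linear elim!: has_cfc_cong)

lemma has_cfc_const: "a \<in> S \<Longrightarrow> has_cfc a (\<lambda>t. c) (c *\<^sub>R e)"
  using has_cfc_poly[of a "[:c:]"] by (auto simp: poly_in_const elim!: has_cfc_cong)

lemma has_cfc_add:
  assumes "has_cfc a f b" "has_cfc a g c"
  shows "has_cfc a (\<lambda>t. f t + g t) (b + c)"
proof -
  obtain p q where p: "uniform_limit (spec a) (\<lambda>n. poly (p n)) f sequentially"
    "(\<lambda>n. poly_in e (p n) a) \<longlonglongrightarrow> b"
    and q: "uniform_limit (spec a) (\<lambda>n. poly (q n)) g sequentially" "(\<lambda>n. poly_in e (q n) a) \<longlonglongrightarrow> c"
    and b: "bounded (f ` spec a)" "bounded (g ` spec a)"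
    using assms by (auto simp: has_cfc_def)
  have "uniform_limit (spec a) (\<lambda>n. poly (p n + q n)) (\<lambda>t. f t + g t) sequentially"
    using uniform_limit_add[OF p(1) q(1)] by (simp add: poly_add[abs_def])
  moreover have "(\<lambda>n. poly_in e (p n + q n) a) \<longlonglongrightarrow> b + c"
    unfolding poly_in_add by (intro tendsto_add p q)
  ultimately show ?thesis
    unfolding has_cfc_def
    by (intro conjI bounded_plus_comp b exI[of _ "\<lambda>n. p n + q n"])
qed

lemma has_cfc_mult:
  assumes a: "a \<in> S" and "has_cfc a f b" "has_cfc a g c"
  shows "has_cfc a (\<lambda>t. f t * g t) (b * c)"
proof -
  obtain p q where p: "uniform_limit (spec a) (\<lambda>n. poly (p n)) f sequentially"
    "(\<lambda>n. poly_in e (p n) a) \<longlonglongrightarrow> b"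
    and q: "uniform_limit (spec a) (\<lambda>n. poly (q n)) g sequentially" "(\<lambda>n. poly_in e (q n) a) \<longlonglongrightarrow> c"
    and b: "bounded (f ` spec a)" "bounded (g ` spec a)"
    using assms by (auto simp: has_cfc_def)
  have "uniform_limit (spec a) (\<lambda>n. poly (p n * q n)) (\<lambda>t. f t * g t) sequentially"
    using uniform_lim_mult[OF p(1) q(1) b] by (simp add: poly_mult[abs_def])
  moreover have "(\<lambda>n. poly_in e (p n * q n) a) \<longlonglongrightarrow> b * c"
    unfolding poly_in_mult[OF a] by (intro tendsto_mult p q)
  moreover have "bounded ((\<lambda>t. f t * g t) ` spec a)"
  proof -
    obtain B C where "\<And>t. t \<in> spec a \<Longrightarrow> \<bar>f t\<bar> \<le> B" "\<And>t. t \<in> spec a \<Longrightarrow> \<bar>g t\<bar> \<le> C"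
      using b by (force simp: bounded_iff)
    then have "\<bar>f t * g t\<bar> \<le> B * C" if "t \<in> spec a" for t
      using that unfolding abs_mult by (meson abs_ge_zero mult_mono order_trans)
    then show ?thesis by (force simp: bounded_iff)
  qed
  ultimately show ?thesis
    unfolding has_cfc_def by (intro conjI exI[of _ "\<lambda>n. p n * q n"])
qed

lemma has_cfc_scale:
  assumes a: "a \<in> S" and f: "has_cfc a f b"
  shows "has_cfc a (\<lambda>t. r * f t) (r *\<^sub>R b)"
  using has_cfc_mult[OF a has_cfc_const[OF a, of r] f] unit_left[OF has_cfc_in[OF a f]] by simp

lemma has_cfc_diff:
  assumes a: "a \<in> S" and f: "has_cfc a f b" and g: "has_cfc a g c"
  shows "has_cfc a (\<lambda>t. f t - g t) (b - c)"
  using has_cfc_add[OF f has_cfc_scale[OF a g, of "-1"]] by simp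

lemma has_cfc_commute:
  assumes a: "a \<in> S" and f: "has_cfc a f b" and g: "has_cfc a g c"
  shows "b * c = c * b"
  using has_cfc_mult[OF a f g] has_cfc_mult[OF a g f] has_cfc_unique[OF a] by (simp add: mult.commute)

text \<open>Weierstrass approximation on an interval around the spectrum; the interval supplies the
  compactness, so no topology of the spectrum is needed. \<open>norm_poly_in_le\<close> turns
  uniform closeness of the polynomials into a Cauchy sequence in the algebra.\<close>

lemma has_cfc_exists:
  assumes a: "a \<in> S" and K: "spec a \<subseteq> {m..M}" and f: "continuous_on {m..M} f"
  obtains b where "has_cfc a f b"
proof -
  have "\<exists>p. \<forall>t\<in>{m..M}. \<bar>f t - poly p t\<bar> < 1 / Suc n" for n :: nat
  proof -
    obtain g where g: "real_polynomial_function g" "\<And>t. t \<in> {m..M} \<Longrightarrow> \<bar>f t - g t\<bar> < 1 / Suc n"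
      using Stone_Weierstrass_real_polynomial_function[OF _ f, of "1 / Suc n"] by auto
    obtain c k where "g = (\<lambda>x. \<Sum>i\<le>k. c i * x ^ i)"
      using g(1) real_polynomial_function_iff_sum by auto
    then have "g = poly (\<Sum>i\<le>k. monom (c i) i)"
      by (simp add: poly_sum poly_monom fun_eq_iff)
    then show ?thesis using g(2) by blast
  qed
  then obtain p where p: "\<And>n t. t \<in> {m..M} \<Longrightarrow> \<bar>f t - poly (p n) t\<bar> < 1 / Suc n"
    by metis
  have small: "\<exists>N. \<forall>n\<ge>N. 1 / real (Suc n) < r" if "r > 0" for r :: real
    using LIMSEQ_inverse_real_of_nat that unfolding LIMSEQ_iff
    by (simp add: inverse_eq_divide del: of_nat_Suc)
  have u: "uniform_limit (spec a) (\<lambda>n. poly (p n)) f sequentially"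
    unfolding uniform_limit_sequentially_iff
  proof (intro allI impI)
    fix r :: real assume "r > 0"
    then obtain N where N: "\<forall>n\<ge>N. 1 / real (Suc n) < r" using small by blast
    have "dist (poly (p n) t) (f t) < r" if "n \<ge> N" "t \<in> spec a" for n t
      using p[of t n] N that K by (force simp: dist_real_def abs_minus_commute)
    then show "\<exists>N. \<forall>n\<ge>N. \<forall>t\<in>spec a. dist (poly (p n) t) (f t) < r" by blast
  qed
  have "Cauchy (\<lambda>n. poly_in e (p n) a)"
  proof (rule CauchyI)
    fix r :: real assume r: "r > 0"
    then obtain N where N: "\<forall>n\<ge>N. 1 / real (Suc n) < r / 4" using small[of "r/4"] by auto
    have "norm (poly_in e (p k) a - poly_in e (p n) a) < r" if kn: "k \<ge> N" "n \<ge> N" for k n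
    proof -
      have "\<bar>poly (p k - p n) t\<bar> \<le> r / 2" if "t \<in> spec a" for t
      proof -
        have "t \<in> {m..M}" using K that by blast
        from p[OF this, of k] p[OF this, of n] have "\<bar>poly (p k) t - poly (p n) t\<bar> < 1 / Suc k + 1 / Suc n"
          by linarith
        moreover have "1 / Suc k < r / 4" "1 / Suc n < r / 4" using N kn by blast+
        ultimately show ?thesis using r by simp
      qed
      then have "norm (poly_in e (p k - p n) a) \<le> r / 2"
        using r by (intro norm_poly_in_le[OF a]) auto
      then show ?thesis using r by (simp add: poly_in_diff)
    qed
    then show "\<exists>N. \<forall>k\<ge>N. \<forall>n\<ge>N. norm (poly_in e (p k) a - poly_in e (p n) a) < r" by blast
  qed
  then obtain b where "(\<lambda>n. poly_in e (p n) a) \<longlonglongrightarrow> b"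
    using Cauchy_convergent_iff convergent_def by blast
  moreover have "bounded (f ` spec a)"
  proof (rule bounded_subset)
    show "bounded (f ` {m..M})"
      by (intro compact_imp_bounded compact_continuous_image f) simp
  qed (use K in blast)
  ultimately show ?thesis using u that unfolding has_cfc_def by blast
qed

section \<open>The positive cone\<close>

definition pos :: "'a \<Rightarrow> bool"
  where "pos a \<longleftrightarrow> a \<in> S \<and> spec a \<subseteq> {0..}"

lemma pos_in: "pos a \<Longrightarrow> a \<in> S"
  by (simp add: pos_def)

lemma pos_invertible:
  assumes "pos a" "t > 0" shows "\<exists>b. inv_pair (a + t *\<^sub>R e) b"
proof -
  have "- t \<notin> spec a" using assms by (auto simp: pos_def)
  then show ?thesis using spec_iff[OF pos_in[OF assms(1)]] by simp
qed

lemma posI: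
  assumes "a \<in> S" "\<And>t. t > 0 \<Longrightarrow> \<exists>b. inv_pair (a + t *\<^sub>R e) b" shows "pos a"
  unfolding pos_def
proof (intro conjI subsetI assms)
  fix t assume "t \<in> spec a"
  then have "\<not> (\<exists>b. inv_pair (a + (- t) *\<^sub>R e) b)" using spec_iff[OF assms(1)] by simp
  then have "\<not> - t > 0" using assms(2) by blast
  then show "t \<in> {0..}" by simp
qed

text \<open>With \<open>norm_le_pos\<close> this trades the spectral condition for the norm
  condition \<open>norm (r e - a) <= r\<close>, so that closure under sums becomes the triangle
  inequality. Here \<open>r - t\<close> takes values in \<open>[0, r]\<close> on the spectrum; the
  converse is a Neumann series.\<close>

lemma pos_norm_le:
  assumes "pos a" "norm a \<le> r" shows "norm (r *\<^sub>R e - a) \<le> r"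
proof -
  have a: "a \<in> S" and sp: "spec a \<subseteq> {0..}" using assms(1) by (auto simp: pos_def)
  have "norm (poly_in e [:r, -1:] a) \<le> r"
  proof (rule norm_poly_in_le[OF a])
    show "0 \<le> r" using assms(2) norm_ge_zero order_trans by blast
    show "\<bar>poly [:r, -1:] t\<bar> \<le> r" if "t \<in> spec a" for t
      using spec_bound[OF a that] sp that assms(2) by force
  qed
  then show ?thesis using unit_right[OF a] by (simp add: poly_in_pCons)
qed

lemma norm_le_pos:
  assumes a: "a \<in> S" and "norm (r *\<^sub>R e - a) \<le> r" shows "pos a"
proof (rule posI[OF a])
  fix t :: real assume "t > 0"
  then have "norm (r *\<^sub>R e - a) < r + t" using assms(2) by simp
  then obtain b where "inv_pair ((r + t) *\<^sub>R e - (r *\<^sub>R e - a)) b"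
    using neumann_scaled[of "r *\<^sub>R e - a"] a unit_in by (blast intro: diff_in scale_in)
  then show "\<exists>b. inv_pair (a + t *\<^sub>R e) b" by (auto simp: algebra_simps)
qed

lemma pos_add:
  assumes "pos a" "pos b" shows "pos (a + b)"
proof (rule norm_le_pos)
  show "a + b \<in> S" using assms by (simp add: pos_in add_in)
  have "(norm a + norm b) *\<^sub>R e - (a + b) = (norm a *\<^sub>R e - a) + (norm b *\<^sub>R e - b)"
    by (simp add: algebra_simps)
  then have "norm ((norm a + norm b) *\<^sub>R e - (a + b))
      \<le> norm (norm a *\<^sub>R e - a) + norm (norm b *\<^sub>R e - b)"
    by (simp only: norm_triangle_ineq)
  also have "\<dots> \<le> norm a + norm b"
    by (intro add_mono pos_norm_le assms order_refl)
  finally show "norm ((norm a + norm b) *\<^sub>R e - (a + b)) \<le> norm a + norm b" .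
qed

lemma pos_scale:
  assumes "pos a" "r \<ge> 0" shows "pos (r *\<^sub>R a)"
proof (rule norm_le_pos)
  show "r *\<^sub>R a \<in> S" using assms by (simp add: pos_in scale_in)
  have "norm ((r * norm a) *\<^sub>R e - r *\<^sub>R a) = r * norm (norm a *\<^sub>R e - a)"
    using assms(2) by (simp flip: scaleR_scaleR scaleR_diff_right)
  also have "\<dots> \<le> r * norm a" by (intro mult_left_mono pos_norm_le assms order_refl)
  finally show "norm ((r * norm a) *\<^sub>R e - r *\<^sub>R a) \<le> r * norm a" .
qed

lemma pos_square:
  assumes c: "c \<in> S" shows "pos (c * c)"
proof (rule posI)
  show "c * c \<in> S" by (rule square_in[OF c])
  show "\<exists>b. inv_pair (c * c + t *\<^sub>R e) b" if "t > 0" for t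
    using shifted_square_invertible[OF c, of "sqrt t" 0] that by simp
qed

lemma spec_shift: "a \<in> S \<Longrightarrow> spec (a + s *\<^sub>R e) = (\<lambda>t. t + s) ` spec a"
proof -
  assume a: "a \<in> S"
  have as: "a + s *\<^sub>R e \<in> S" using a by (simp add: add_in scale_in unit_in)
  have "t \<in> spec (a + s *\<^sub>R e) \<longleftrightarrow> t - s \<in> spec a" for t
    by (simp add: spec_iff a as algebra_simps)
  then show ?thesis by (force simp: image_iff algebra_simps)
qed

lemma pos_diff_scaled_unit:
  assumes "a \<in> S" shows "pos (a - s *\<^sub>R e) \<longleftrightarrow> spec a \<subseteq> {s..}"
proof -
  have "a - s *\<^sub>R e \<in> S" using assms by (simp add: diff_in scale_in unit_in)
  then show ?thesis using spec_shift[OF assms, of "- s"] by (auto simp: pos_def)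
qed

text \<open>\<open>a - t = a (e - t b)\<close> is invertible while \<open>t * norm b < 1\<close>, so
  the spectrum keeps a distance from 0. On the resulting interval \<open>ln\<close> and all real
  powers are continuous.\<close>

lemma pos_invertible_lower_bound:
  assumes "pos a" "inv_pair a b"
  obtains m where "m > 0" "spec a \<subseteq> {m..norm a}"
proof -
  have a: "a \<in> S" "spec a \<subseteq> {0..}" using assms by (auto simp: pos_def)
  have b: "b \<in> S" using assms by (auto simp: inv_pair_def)
  \<comment> \<open>The summand 1 makes \<open>m * norm b < 1\<close> strict and the denominator
    nonzero.\<close>
  define m where "m = 1 / (norm b + 1)"
  have n: "norm b + 1 > 0" using norm_ge_zero[of b] by linarith
  then have m: "m > 0" by (simp add: m_def)
  have "m \<le> t" if t: "t \<in> spec a" for t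
  proof (rule ccontr)
    assume "\<not> m \<le> t"
    then have tm: "0 \<le> t" "t < m" using a t by auto
    have "t * norm b < 1"
    proof -
      have "t * norm b \<le> m * norm b" using tm by (intro mult_right_mono) auto
      also have "\<dots> < 1" using n by (simp add: m_def)
      finally show ?thesis .
    qed
    then obtain c where c: "inv_pair (e - t *\<^sub>R b) c"
      using neumann_inv_pair[of "t *\<^sub>R b"] b tm by (auto simp: scale_in)
    have ab: "a * b = e" "b * a = e" using assms(2) by (auto simp: inv_pair_def)
    have "a * (e - t *\<^sub>R b) = a - t *\<^sub>R e" "(e - t *\<^sub>R b) * a = a - t *\<^sub>R e"
      using ab unit_left[OF a(1)] unit_right[OF a(1)] by (simp_all add: algebra_simps)
    then have "\<exists>d. inv_pair (a - t *\<^sub>R e) d"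
      using inv_pair_mult[OF assms(2) c] by auto
    then show False using t spec_iff[OF a(1)] by blast
  qed
  moreover have "t \<le> norm a" if "t \<in> spec a" for t
    using spec_bound[OF a(1) that] by linarith
  ultimately show ?thesis using m that by force
qed

lemma sandwich_inv_pair:
  assumes d: "inv_pair d c" and y: "inv_pair y z"
  shows "inv_pair (d * y * d) (c * z * c)"
proof -
  have S: "d * y * d \<in> S" "c * z * c \<in> S" using assms by (auto simp: inv_pair_def sandwich_in)
  have in_S: "d \<in> S" "c \<in> S" "y \<in> S" "z \<in> S" and eqs: "d * c = e" "c * d = e" "y * z = e" "z * y = e"
    using assms by (auto simp: inv_pair_def)
  have "d * y * d * (c * z * c) = d * (y * ((d * c) * z)) * c" by (simp only: mult.assoc)
  then have 1: "d * y * d * (c * z * c) = e" using in_S eqs by (simp add: unit_left unit_right)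
  have "c * z * c * (d * y * d) = c * (z * ((c * d) * y)) * d" by (simp only: mult.assoc)
  then have 2: "c * z * c * (d * y * d) = e" using in_S eqs by (simp add: unit_left unit_right)
  show ?thesis using S 1 2 by (simp add: inv_pair_def)
qed

text \<open>Writing \<open>dyd + t = d (y + t c\<^sup>2) d\<close> with \<open>c = d\<^sup>-\<^sup>1\<close> reduces the invertibility of
  \<open>dyd + t\<close> to the fact that the positive elements form a convex cone; this avoids
  the theorem that every \<open>x\<^sup>* x\<close> is positive.\<close>
lemma pos_sandwich:
  assumes y: "pos y" and d: "inv_pair d c"
  shows "pos (d * y * d)"
proof (rule posI)
  have in_S: "d \<in> S" "c \<in> S" "y \<in> S" and eqs: "d * c = e" "c * d = e"
    using assms by (auto simp: inv_pair_def pos_in)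
  show "d * y * d \<in> S" using in_S by (simp add: sandwich_in)
  fix t :: real assume t: "t > 0"
  have cc: "pos (c * c)" "inv_pair (c * c) (d * d)"
    using pos_square[OF in_S(2)] inv_pair_mult[OF inv_pair_sym[OF d] inv_pair_sym[OF d]] by simp_all
  \<comment> \<open>The gap allows writing \<open>t c^2 = t (c^2 - m) + t m\<close>, a positive
    element plus a positive multiple of \<open>e\<close>; the latter is what
    \<open>pos_invertible\<close> needs.\<close>
  obtain m where m: "m > 0" "spec (c * c) \<subseteq> {m..norm (c * c)}"
    using pos_invertible_lower_bound[OF cc] .
  have "spec (c * c) \<subseteq> {m..}" using m(2) by auto
  then have "pos (c * c - m *\<^sub>R e)"
    using pos_diff_scaled_unit[OF pos_in[OF cc(1)]] by simp
  then have "pos (y + t *\<^sub>R (c * c - m *\<^sub>R e))"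
    using y t by (intro pos_add pos_scale) auto
  then obtain b where "inv_pair (y + t *\<^sub>R (c * c - m *\<^sub>R e) + (t * m) *\<^sub>R e) b"
    using pos_invertible m(1) t by (metis mult_pos_pos)
  then have b: "inv_pair (y + t *\<^sub>R (c * c)) b" by (simp add: algebra_simps)
  have "d * (c * c) * d = (d * c) * (c * d)" by (simp only: mult.assoc)
  then have "d * (y + t *\<^sub>R (c * c)) * d = d * y * d + t *\<^sub>R e"
    using eqs by (simp add: distrib_left distrib_right)
  then show "\<exists>b. inv_pair (d * y * d + t *\<^sub>R e) b"
    using sandwich_inv_pair[OF d b] by auto
qed

text \<open>The calculus applied to \<open>sqrt (f t)\<close> gives a root of \<open>b\<close> in
  \<open>S\<close>, so \<open>b\<close> is a square. This takes the place of a spectral mapping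
  theorem for continuous functions.\<close>

lemma has_cfc_pos:
  assumes a: "a \<in> S" and K: "spec a \<subseteq> {m..M}" and f: "continuous_on {m..M} f"
    and nonneg: "\<And>t. t \<in> {m..M} \<Longrightarrow> 0 \<le> f t" and b: "has_cfc a f b"
  shows "pos b"
proof -
  have "continuous_on {m..M} (\<lambda>t. sqrt (f t))" by (intro continuous_intros f)
  from has_cfc_exists[OF a K this] obtain c where c: "has_cfc a (\<lambda>t. sqrt (f t)) c" .
  have "has_cfc a f (c * c)"
    by (rule has_cfc_cong[OF has_cfc_mult[OF a c c]]) (use nonneg K in auto)
  then have "b = c * c" using has_cfc_unique[OF a b] by blast
  then show ?thesis using pos_square[OF has_cfc_in[OF a c]] by simp
qed

lemma has_cfc_inverse:
  assumes a: "a \<in> S" and K: "spec a \<subseteq> {m..M}" and f: "continuous_on {m..M} f"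
    and g: "has_cfc a g c" and inv: "\<And>t. t \<in> {m..M} \<Longrightarrow> f t * g t = 1" and b: "has_cfc a f b"
  shows "inv_pair b c"
proof -
  have e: "has_cfc a (\<lambda>t. 1) e" using has_cfc_const[OF a, of 1] by simp
  have "has_cfc a (\<lambda>t. 1) (b * c)"
    by (rule has_cfc_cong[OF has_cfc_mult[OF a b g]]) (use inv K in auto)
  then have "b * c = e" using has_cfc_unique[OF a _ e] by blast
  moreover have "b * c = c * b" by (rule has_cfc_commute[OF a b g])
  ultimately show ?thesis using has_cfc_in[OF a] b g by (simp add: inv_pair_def)
qed

end

section \<open>The chain of inequalities\<close>

lemma ln_lower_bound:
  assumes "1 \<le> (u::real)" shows "2 * (u - 1) / (u + 1) \<le> ln u"
proof -
  have "(\<lambda>u. ln u - 2 * (u - 1) / (u + 1)) 1 \<le> (\<lambda>u. ln u - 2 * (u - 1) / (u + 1)) u"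
  proof (rule DERIV_nonneg_imp_nondecreasing[OF assms])
    fix x :: real assume x: "1 \<le> x"
    have eq: "1 / x - (2 * (x + 1) - 2 * (x - 1)) / ((x + 1) * (x + 1))
        = (x - 1)\<^sup>2 / (x * (x + 1)\<^sup>2)"
    proof -
      have "x \<noteq> 0" "x + 1 \<noteq> 0" using x by auto
      then show ?thesis by (simp add: divide_simps) (simp add: algebra_simps power2_eq_square)
    qed
    have "((\<lambda>u. ln u - 2 * (u - 1) / (u + 1)) has_real_derivative
        1 / x - (2 * (x + 1) - 2 * (x - 1)) / ((x + 1) * (x + 1))) (at x)"
      using x by (auto intro!: derivative_eq_intros)
    then show "\<exists>y. ((\<lambda>u. ln u - 2 * (u - 1) / (u + 1)) has_real_derivative y) (at x) \<and> y \<ge> 0"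
      unfolding eq using x by (intro exI conjI) auto
  qed
  then show ?thesis by simp
qed

lemma ln_upper_bound:
  assumes "1 \<le> (u::real)" shows "ln u \<le> (u - 1 / u) / 2"
proof -
  have "(\<lambda>u. (u - 1 / u) / 2 - ln u) 1 \<le> (\<lambda>u. (u - 1 / u) / 2 - ln u) u"
  proof (rule DERIV_nonneg_imp_nondecreasing[OF assms])
    fix x :: real assume x: "1 \<le> x"
    have eq: "(1 + 1 / (x * x)) / 2 - 1 / x = (1 - 1 / x)\<^sup>2 / 2"
      using x by (simp add: field_simps power2_eq_square)
    have "((\<lambda>u. (u - 1 / u) / 2 - ln u) has_real_derivative (1 + 1 / (x * x)) / 2 - 1 / x) (at x)"
      using x by (auto intro!: derivative_eq_intros)
    then show "\<exists>y. ((\<lambda>u. (u - 1 / u) / 2 - ln u) has_real_derivative y) (at x) \<and> y \<ge> 0"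
      unfolding eq by (intro exI conjI) auto
  qed
  then show ?thesis by simp
qed

text \<open>With \<open>u = sqrt (t / \<delta>)\<close>, the five bounds, in the order I', II', S, III', V', are
  \<open>t powr \<alpha> * (ln \<delta> + log_chain i u)\<close> in the functional calculus.\<close>
definition log_chain :: "nat \<Rightarrow> real \<Rightarrow> real"
  where "log_chain i u = [2 * (u\<^sup>2 - 1) / (u\<^sup>2 + 1), 4 * (u - 1) / (u + 1), 2 * ln u,
    u - 1 / u, (u\<^sup>2 - 1 / u\<^sup>2) / 2] ! i"

lemma log_chain_simps:
  "log_chain 0 u = 2 * (u\<^sup>2 - 1) / (u\<^sup>2 + 1)"
  "log_chain (Suc 0) u = 4 * (u - 1) / (u + 1)"
  "log_chain 2 u = 2 * ln u"
  "log_chain 3 u = u - 1 / u"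
  "log_chain 4 u = (u\<^sup>2 - 1 / u\<^sup>2) / 2"
  by (simp_all add: log_chain_def)

text \<open>Behind the chain are the bounds \<open>2(x - 1)/(x + 1) <= ln x <= (x - 1/x)/2\<close>
  for \<open>x >= 1\<close>. Taken at \<open>x = u^2\<close> they give the outer members, taken at
  \<open>x = u\<close> and doubled the inner ones. That doubling sharpens them is seen by factoring
  the differences, which carry \<open>(u - 1)^3\<close> and
  \<open>(u^2 - 1)(u - 1)^2\<close>.\<close>

lemma log_chain_mono_step:
  assumes u: "1 \<le> u"
  shows "log_chain 0 u \<le> log_chain (Suc 0) u" "log_chain (Suc 0) u \<le> log_chain 2 u"
    "log_chain 2 u \<le> log_chain 3 u" "log_chain 3 u \<le> log_chain 4 u"
proof -
  have pos: "u\<^sup>2 + 1 > 0" "u + 1 > 0" using u by (auto intro: add_nonneg_pos)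
  have "4 * (u - 1) / (u + 1) - 2 * (u\<^sup>2 - 1) / (u\<^sup>2 + 1) = 2 * (u - 1) ^ 3 / ((u + 1) * (u\<^sup>2 + 1))"
    using pos by (simp add: divide_simps) (simp add: algebra_simps power2_eq_square power3_eq_cube)
  moreover have "\<dots> \<ge> 0" using u pos by (intro divide_nonneg_pos mult_pos_pos) auto
  ultimately show "log_chain 0 u \<le> log_chain (Suc 0) u" unfolding log_chain_simps by linarith
  have "4 * (u - 1) / (u + 1) = 2 * (2 * (u - 1) / (u + 1))" by simp
  then show "log_chain (Suc 0) u \<le> log_chain 2 u"
    using ln_lower_bound[OF u] unfolding log_chain_simps by linarith
  show "log_chain 2 u \<le> log_chain 3 u"
    using ln_upper_bound[OF u] by (simp add: log_chain_simps)
  have "(u\<^sup>2 - 1 / u\<^sup>2) / 2 - (u - 1 / u) = (u\<^sup>2 - 1) * (u - 1)\<^sup>2 / (2 * u\<^sup>2)"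
    using u by (simp add: divide_simps) (simp add: algebra_simps power2_eq_square power4_eq_xxxx)
  moreover have "\<dots> \<ge> 0" using u by (intro divide_nonneg_pos mult_nonneg_nonneg) auto
  ultimately show "log_chain 3 u \<le> log_chain 4 u" unfolding log_chain_simps by linarith
qed

lemma log_chain_inverse:
  assumes "0 < u" "i < 5" shows "log_chain i (1 / u) = - log_chain i u"
proof -
  have *: "(1 / w - 1) / (1 / w + 1) = - ((w - 1) / (w + 1))" if "0 < w" for w :: real
  proof -
    have "1 / w - 1 = - (w - 1) / w" "1 / w + 1 = (w + 1) / w"
      using that by (simp_all add: field_simps)
    then show ?thesis using that by (simp add: minus_divide_left)
  qed
  consider "i = 0" | "i = Suc 0" | "i = 2" | "i = 3" | "i = 4" using assms(2) by linarith
  then show ?thesis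
  proof cases
    case 1
    then show ?thesis
      using *[of "u\<^sup>2"] assms(1) unfolding 1 log_chain_simps power_one_over
      by (simp only: times_divide_eq_right[symmetric]) simp
  next
    case 2
    then show ?thesis
      using *[of u] assms(1) unfolding 2 log_chain_simps
      by (simp only: times_divide_eq_right[symmetric])
  next
    case 3
    then show ?thesis using assms(1) by (simp add: log_chain_simps ln_div)
  next
    case 4
    then show ?thesis by (simp add: log_chain_simps)
  next
    case 5
    then show ?thesis by (simp add: log_chain_simps power_one_over field_simps)
  qed
qed

lemma log_chain_antimono_step:
  assumes u: "0 < u" "u \<le> 1"
  shows "log_chain (Suc 0) u \<le> log_chain 0 u" "log_chain 2 u \<le> log_chain (Suc 0) u"
    "log_chain 3 u \<le> log_chain 2 u" "log_chain 4 u \<le> log_chain 3 u"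
  using log_chain_mono_step[of "1 / u"] log_chain_inverse[OF u(1)] u by simp_all

definition chain_fun :: "nat \<Rightarrow> real \<Rightarrow> real \<Rightarrow> real \<Rightarrow> real"
  where "chain_fun i \<delta> \<alpha> t = t powr \<alpha> * (ln \<delta> + log_chain i (sqrt (t / \<delta>)))"

lemma continuous_on_chain_fun:
  assumes "0 < m" "0 < \<delta>" "i < 5"
  shows "continuous_on {m..M} (chain_fun i \<delta> \<alpha>)"
proof -
  have [simp]: "x / \<delta> + 1 \<noteq> 0" "sqrt (x / \<delta>) + 1 \<noteq> 0" "x \<noteq> 0" "sqrt (x / \<delta>) > 0"
    if "x \<ge> m" for x
    using assms that divide_pos_pos[of x \<delta>] real_sqrt_gt_zero[of "x / \<delta>"] by linarith+
  have [simp]: "u\<^sup>2 + 1 \<noteq> 0" for u :: real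
    using zero_le_power2[of u] by linarith
  have L: "continuous_on {m..M} (\<lambda>t. log_chain i (sqrt (t / \<delta>)))"
  proof -
    consider "i = 0" | "i = Suc 0" | "i = 2" | "i = 3" | "i = 4" using assms(3) by linarith
    then show ?thesis
      by cases (use assms in \<open>auto simp: log_chain_simps intro!: continuous_intros\<close>)
  qed
  show ?thesis
    unfolding chain_fun_def using assms(1) by (intro continuous_intros L) auto
qed

text \<open>The constants of I' and II' come from \<open>2(w - 1)/(w + 1) = 2 - 4/(w + 1)\<close>:
  with \<open>w = t/\<delta>\<close> it yields \<open>ln \<delta> + 2\<close> and
  \<open>4 \<delta>\<close>, and its double with \<open>w = sqrt (t/\<delta>)\<close> yields
  \<open>ln \<delta> + 4\<close> and \<open>8 sqrt \<delta>\<close>.\<close>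

lemma chain_fun_simps:
  assumes t: "0 < t" and d: "0 < \<delta>"
  shows "chain_fun 0 \<delta> \<alpha> t = (ln \<delta> + 2) * t powr \<alpha> - 4 * \<delta> * (1 / (t + \<delta>) * t powr \<alpha>)"
    "chain_fun 1 \<delta> \<alpha> t = (ln \<delta> + 4) * t powr \<alpha> - 8 * sqrt \<delta> * (1 / (t powr (1/2) + sqrt \<delta>) * t powr \<alpha>)"
    "chain_fun 2 \<delta> \<alpha> t = t powr \<alpha> * ln t"
    "chain_fun 3 \<delta> \<alpha> t = 1 / sqrt \<delta> * t powr (\<alpha> + 1/2) - sqrt \<delta> * t powr (\<alpha> - 1/2) + ln \<delta> * t powr \<alpha>"
    "chain_fun 4 \<delta> \<alpha> t = 1/2 * (1 / \<delta> * t powr (\<alpha> + 1) - \<delta> * t powr (\<alpha> - 1)) + ln \<delta> * t powr \<alpha>"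
proof -
  define p where "p = t powr \<alpha>"
  define s r where "s = sqrt t" and "r = sqrt \<delta>"
  have sr: "s > 0" "r > 0" "t = s\<^sup>2" "\<delta> = r\<^sup>2" "sqrt (t / \<delta>) = s / r" "(s / r)\<^sup>2 = t / \<delta>"
    using t d by (auto simp: s_def r_def real_sqrt_divide power_divide)
  have half: "t powr (1/2) = s" using t by (simp add: s_def powr_half_sqrt)
  have pw: "t powr (\<alpha> + 1/2) = p * s" "t powr (\<alpha> - 1/2) = p / s"
    "t powr (\<alpha> + 1) = p * t" "t powr (\<alpha> - 1) = p / t"
    using t half by (simp_all add: powr_add powr_diff p_def)
  have "t / \<delta> + 1 = (t + \<delta>) / \<delta>" "t / \<delta> - 1 = (t - \<delta>) / \<delta>"
    using d by (simp_all add: field_simps)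
  then have eq0: "2 * (t / \<delta> - 1) / (t / \<delta> + 1) = 2 - 4 * \<delta> / (t + \<delta>)"
    using t d by (simp add: divide_simps)
  show "chain_fun 0 \<delta> \<alpha> t = (ln \<delta> + 2) * t powr \<alpha> - 4 * \<delta> * (1 / (t + \<delta>) * t powr \<alpha>)"
    unfolding chain_fun_def log_chain_simps sr(5) sr(6) eq0 by (simp add: algebra_simps)
  have "s / r + 1 = (s + r) / r" "s / r - 1 = (s - r) / r"
    using sr(2) by (simp_all add: field_simps)
  then have eq1: "4 * (s / r - 1) / (s / r + 1) = 4 - 8 * r / (s + r)"
    using sr(1,2) by (simp add: divide_simps)
  show "chain_fun 1 \<delta> \<alpha> t
      = (ln \<delta> + 4) * t powr \<alpha> - 8 * sqrt \<delta> * (1 / (t powr (1/2) + sqrt \<delta>) * t powr \<alpha>)"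
    unfolding chain_fun_def One_nat_def log_chain_simps sr(5) half r_def[symmetric] eq1
    by (simp add: algebra_simps)
  show "chain_fun 2 \<delta> \<alpha> t = t powr \<alpha> * ln t"
    using t d by (simp add: chain_fun_def log_chain_simps ln_sqrt ln_div diff_divide_distrib)
  show "chain_fun 3 \<delta> \<alpha> t
      = 1 / sqrt \<delta> * t powr (\<alpha> + 1/2) - sqrt \<delta> * t powr (\<alpha> - 1/2) + ln \<delta> * t powr \<alpha>"
    unfolding chain_fun_def log_chain_simps sr(5) pw r_def[symmetric] p_def[symmetric]
    using sr(1,2) by (simp add: field_simps)
  show "chain_fun 4 \<delta> \<alpha> t
      = 1/2 * (1 / \<delta> * t powr (\<alpha> + 1) - \<delta> * t powr (\<alpha> - 1)) + ln \<delta> * t powr \<alpha>"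
    unfolding chain_fun_def log_chain_simps sr(5) sr(6) pw p_def[symmetric]
    using t d by (simp add: field_simps)
qed

context jordan_calculus
begin

section \<open>The five terms as conjugates of functions of \<open>X\<close>\<close>

lemma has_cfc_cfc:
  assumes "a \<in> S" "spec a \<subseteq> {m..M}" "continuous_on {m..M} f"
  shows "has_cfc a f (cfc U e f a)"
  using has_cfc_exists[OF assms] cfc_eqI[OF assms(1)] by metis

lemma continuous_on_powr_pos: "0 < m \<Longrightarrow> continuous_on {m..M} (\<lambda>t::real. t powr r)"
  by (intro continuous_intros) auto

lemma has_cfc_rpow:
  assumes "a \<in> S" "spec a \<subseteq> {m..M}" "0 < m"
  shows "has_cfc a (\<lambda>t. t powr r) (rpow U e a r)"
  unfolding rpow_def using assms by (intro has_cfc_cfc continuous_on_powr_pos)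

lemma rpow_inv_pair:
  assumes "a \<in> S" "spec a \<subseteq> {m..M}" "0 < m"
  shows "inv_pair (rpow U e a r) (rpow U e a (- r))"
  using assms
  by (intro has_cfc_inverse[OF assms(1,2) continuous_on_powr_pos has_cfc_rpow _ has_cfc_rpow])
    (auto simp flip: powr_add)

text \<open>\<open>alg_inv\<close> is defined by the calculus of \<open>a\<close>. Once the spectrum
  is bounded away from 0, it is an algebraic inverse, and inverses are unique.\<close>

lemma alg_inv_eq:
  assumes a: "a \<in> S" "spec a \<subseteq> {m..}" "0 < m" and ab: "inv_pair a b"
  shows "alg_inv U e a = b"
proof -
  have K: "spec a \<subseteq> {m..norm a}" using a(2) spec_bound[OF a(1)] by force
  have "inv_pair a (alg_inv U e a)"
    unfolding alg_inv_def
    by (rule has_cfc_inverse[OF a(1) K continuous_on_id has_cfc_cfc[OF a(1) K] _ has_cfc_id[OF a(1)]])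
      (use a(3) in \<open>auto intro!: continuous_intros\<close>)
  then show ?thesis using inv_pair_unique ab by blast
qed

text \<open>I' and II' contain the calculus of another element than \<open>X\<close>, namely
  \<open>X + \<delta>\<close> or \<open>X^(1/2) + sqrt \<delta>\<close>. In place of a composition
  law, uniqueness of inverses is used: \<open>1/(f + d)\<close> evaluated at \<open>X\<close> is
  also an inverse of \<open>Y + d\<close>.\<close>

lemma alg_inv_add_unit:
  assumes X: "X \<in> S" "spec X \<subseteq> {m..M}" and f: "continuous_on {m..M} f" "\<And>t. t \<in> {m..M} \<Longrightarrow> 0 \<le> f t"
    and Y: "has_cfc X f Y" and d: "0 < d"
  shows "has_cfc X (\<lambda>t. 1 / (f t + d)) (alg_inv U e (Y + d *\<^sub>R e))"
proof -
  have ne: "f t + d \<noteq> 0" if "t \<in> {m..M}" for t using f(2)[OF that] d by linarith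
  have "continuous_on {m..M} (\<lambda>t. 1 / (f t + d))"
    by (intro continuous_intros f) (use ne in auto)
  from has_cfc_exists[OF X this] obtain c where c: "has_cfc X (\<lambda>t. 1 / (f t + d)) c" .
  have YS: "Y \<in> S" by (rule has_cfc_in[OF X(1) Y])
  have "has_cfc X (\<lambda>t. f t + d) (Y + d *\<^sub>R e)"
    by (rule has_cfc_add[OF Y has_cfc_const[OF X(1)]])
  then have inv: "inv_pair (Y + d *\<^sub>R e) c"
    using ne by (intro has_cfc_inverse[OF X _ c]) (auto intro!: continuous_intros f)
  have "pos Y" by (rule has_cfc_pos[OF X f Y])
  then have "spec Y \<subseteq> {0..}" by (simp add: pos_def)
  then have "spec (Y + d *\<^sub>R e) \<subseteq> {d..}" using spec_shift[OF YS] by auto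
  then have "alg_inv U e (Y + d *\<^sub>R e) = c"
    using d inv by (intro alg_inv_eq) (auto simp: inv_pair_def)
  then show ?thesis using c by simp
qed

text \<open>The interval is left open: the first chain uses \<open>[\<delta>, norm X]\<close>, the
  reversed one \<open>[m, \<delta>]\<close>.\<close>

lemma bounds_as_cfc:
  assumes X: "X \<in> S" "spec X \<subseteq> {m..M}" "0 < m" and d: "0 < \<delta>"
    and Xdef: "X = rel_elem U e \<beta> A B"
  shows "\<exists>K. (\<forall>i<5. has_cfc X (chain_fun i \<delta> \<alpha>) (K i)) \<and>
    bound_I U e \<delta> \<alpha> \<beta> A B = rpow U e A (\<beta>/2) * K 0 * rpow U e A (\<beta>/2) \<and>
    bound_II U e \<delta> \<alpha> \<beta> A B = rpow U e A (\<beta>/2) * K 1 * rpow U e A (\<beta>/2) \<and>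
    rel_entropy U e \<alpha> \<beta> A B = rpow U e A (\<beta>/2) * K 2 * rpow U e A (\<beta>/2) \<and>
    bound_III U e \<delta> \<alpha> \<beta> A B = rpow U e A (\<beta>/2) * K 3 * rpow U e A (\<beta>/2) \<and>
    bound_V U e \<delta> \<alpha> \<beta> A B = rpow U e A (\<beta>/2) * K 4 * rpow U e A (\<beta>/2)"
proof -
  note pw = has_cfc_rpow[OF X]
  note scale = has_cfc_scale[OF X(1)] and diff = has_cfc_diff[OF X(1)] and mult = has_cfc_mult[OF X(1)]
  let ?P = "rpow U e X"
  let ?I = "alg_inv U e (X + \<delta> *\<^sub>R e)" and ?J = "alg_inv U e (?P (1/2) + sqrt \<delta> *\<^sub>R e)"
  have I: "has_cfc X (\<lambda>t. 1 / (t + \<delta>)) ?I"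
    using X(3) d by (intro alg_inv_add_unit[OF X(1,2) _ _ has_cfc_id[OF X(1)]]) (auto intro: continuous_intros)
  have J: "has_cfc X (\<lambda>t. 1 / (t powr (1/2) + sqrt \<delta>)) ?J"
    using X(3) d by (intro alg_inv_add_unit[OF X(1,2) continuous_on_powr_pos _ pw]) auto
  have L: "has_cfc X ln (alg_log U e X)"
    unfolding alg_log_def using X(3) by (intro has_cfc_cfc[OF X(1,2)] continuous_intros) auto
  define K0 where "K0 = (ln \<delta> + 2) *\<^sub>R ?P \<alpha> - (4 * \<delta>) *\<^sub>R (?I * ?P \<alpha>)"
  define K1 where "K1 = (ln \<delta> + 4) *\<^sub>R ?P \<alpha> - (8 * sqrt \<delta>) *\<^sub>R (?J * ?P \<alpha>)"
  define K2 where "K2 = ?P \<alpha> * alg_log U e X"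
  define K3 where "K3 = (1 / sqrt \<delta>) *\<^sub>R ?P (\<alpha> + 1/2) - sqrt \<delta> *\<^sub>R ?P (\<alpha> - 1/2) + ln \<delta> *\<^sub>R ?P \<alpha>"
  define K4 where "K4 = (1/2) *\<^sub>R ((1 / \<delta>) *\<^sub>R ?P (\<alpha> + 1) - \<delta> *\<^sub>R ?P (\<alpha> - 1)) + ln \<delta> *\<^sub>R ?P \<alpha>"
  have t: "0 < t" if "t \<in> spec X" for t using that X(2,3) by force
  have "has_cfc X (chain_fun 0 \<delta> \<alpha>) K0"
    unfolding K0_def
    by (rule has_cfc_cong[OF diff[OF scale[OF pw] scale[OF mult[OF I pw]]]])
      (simp only: chain_fun_simps[OF t d])
  moreover have "has_cfc X (chain_fun 1 \<delta> \<alpha>) K1"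
    unfolding K1_def
    by (rule has_cfc_cong[OF diff[OF scale[OF pw] scale[OF mult[OF J pw]]]])
      (simp only: chain_fun_simps[OF t d])
  moreover have "has_cfc X (chain_fun 2 \<delta> \<alpha>) K2"
    unfolding K2_def by (rule has_cfc_cong[OF mult[OF pw L]]) (simp only: chain_fun_simps[OF t d])
  moreover have "has_cfc X (chain_fun 3 \<delta> \<alpha>) K3"
    unfolding K3_def
    by (rule has_cfc_cong[OF has_cfc_add[OF diff[OF scale[OF pw] scale[OF pw]] scale[OF pw]]])
      (simp only: chain_fun_simps[OF t d])
  moreover have "has_cfc X (chain_fun 4 \<delta> \<alpha>) K4"
    unfolding K4_def
    by (rule has_cfc_cong[OF has_cfc_add[OF scale[OF diff[OF scale[OF pw] scale[OF pw]]] scale[OF pw]]])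
      (simp only: chain_fun_simps[OF t d])
  ultimately have K: "has_cfc X (chain_fun i \<delta> \<alpha>) ([K0, K1, K2, K3, K4] ! i)" if "i < 5" for i
    using that by (auto simp: less_Suc_eq numeral_eq_Suc)
  show ?thesis
    by (rule exI[of _ "\<lambda>i. [K0, K1, K2, K3, K4] ! i"], intro conjI allI impI, erule K)
      (simp_all add: K0_def K1_def K2_def K3_def K4_def bound_I_def bound_II_def rel_entropy_def
        bound_III_def bound_V_def geo_mean_def Let_def Xdef[symmetric] algebra_simps)
qed

lemma sandwich_mono:
  assumes X: "X \<in> S" "spec X \<subseteq> {m..M}" and c: "inv_pair c d"
    and f: "has_cfc X f K" "continuous_on {m..M} f" and g: "has_cfc X g L" "continuous_on {m..M} g"
    and le: "\<And>t. t \<in> {m..M} \<Longrightarrow> f t \<le> g t"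
  shows "pos (c * L * c - c * K * c)"
proof -
  have "pos (L - K)"
    by (rule has_cfc_pos[OF X _ _ has_cfc_diff[OF X(1) g(1) f(1)]])
      (use f g le in \<open>auto intro!: continuous_intros\<close>)
  from pos_sandwich[OF this c] show ?thesis by (simp add: algebra_simps)
qed

lemma rel_elem_facts:
  assumes A: "pos A" "invertible_in U e A" and B: "pos B" "invertible_in U e B"
  obtains m where "0 < m" "rel_elem U e \<beta> A B \<in> S"
    "spec (rel_elem U e \<beta> A B) \<subseteq> {m..norm (rel_elem U e \<beta> A B)}"
    "inv_pair (rpow U e A (\<beta>/2)) (rpow U e A (- \<beta>/2))"
    "rpow U e A (\<beta>/2) * rpow U e A (\<beta>/2) = rpow U e A \<beta>"
proof -
  obtain A' where "inv_pair A A'" using A invertible_in_iff[OF pos_in] by blast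
  from pos_invertible_lower_bound[OF A(1) this] obtain k where k: "0 < k" "spec A \<subseteq> {k..norm A}" .
  have AS: "A \<in> S" using A(1) by (rule pos_in)
  let ?c = "rpow U e A (\<beta>/2)" and ?d = "rpow U e A (- \<beta>/2)"
  have c: "inv_pair ?c ?d" using rpow_inv_pair[OF AS k(2,1), of "\<beta>/2"] by simp
  have "has_cfc A (\<lambda>t. t powr \<beta>) (?c * ?c)"
    by (rule has_cfc_cong[OF has_cfc_mult[OF AS has_cfc_rpow[OF AS k(2,1)] has_cfc_rpow[OF AS k(2,1)]]])
      (simp flip: powr_add)
  then have cc: "?c * ?c = rpow U e A \<beta>"
    using has_cfc_unique[OF AS _ has_cfc_rpow[OF AS k(2,1)]] by blast
  obtain B' where B': "inv_pair B B'" using B invertible_in_iff[OF pos_in] by blast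
  have X: "pos (rel_elem U e \<beta> A B)"
    unfolding rel_elem_def by (rule pos_sandwich[OF B(1) inv_pair_sym[OF c]])
  have "inv_pair (rel_elem U e \<beta> A B) (?c * B' * ?c)"
    unfolding rel_elem_def by (rule sandwich_inv_pair[OF inv_pair_sym[OF c] B'])
  from pos_invertible_lower_bound[OF X this] obtain m
    where "0 < m" "spec (rel_elem U e \<beta> A B) \<subseteq> {m..norm (rel_elem U e \<beta> A B)}" .
  then show ?thesis using that pos_in[OF X] c cc by blast
qed

text \<open>With \<open>c\<close> and \<open>d\<close> the powers of \<open>A\<close> to
  \<open>\<beta>/2\<close> and \<open>-\<beta>/2\<close>, this is how conjugation turns
  \<open>A\<close> to the power \<open>\<beta>\<close> into \<open>e\<close>.\<close>

lemma conjugate_unit: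
  assumes "inv_pair c d" shows "d * (c * c) * d = e"
proof -
  have "d * (c * c) * d = (d * c) * (c * d)" by (simp only: mult.assoc)
  then show ?thesis using assms by (simp add: inv_pair_def)
qed

theorem entropy_bounds_above:
  assumes A: "pos A" "invertible_in U e A" and B: "pos B" "invertible_in U e B"
    and d: "0 < \<delta>" and le: "pos (B - \<delta> *\<^sub>R rpow U e A \<beta>)"
  shows "pos (bound_II U e \<delta> \<alpha> \<beta> A B - bound_I U e \<delta> \<alpha> \<beta> A B) \<and>
    pos (rel_entropy U e \<alpha> \<beta> A B - bound_II U e \<delta> \<alpha> \<beta> A B) \<and>
    pos (bound_III U e \<delta> \<alpha> \<beta> A B - rel_entropy U e \<alpha> \<beta> A B) \<and>
    pos (bound_V U e \<delta> \<alpha> \<beta> A B - bound_III U e \<delta> \<alpha> \<beta> A B)"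
proof -
  define X where "X = rel_elem U e \<beta> A B"
  let ?c = "rpow U e A (\<beta>/2)" and ?d = "rpow U e A (- \<beta>/2)"
  obtain m where m: "X \<in> S" "inv_pair ?c ?d" "?c * ?c = rpow U e A \<beta>"
    unfolding X_def by (rule rel_elem_facts[OF A B])
  have "X - \<delta> *\<^sub>R e = ?d * (B - \<delta> *\<^sub>R rpow U e A \<beta>) * ?d"
    using conjugate_unit[OF m(2)] by (simp add: X_def rel_elem_def algebra_simps m(3))
  then have "pos (X - \<delta> *\<^sub>R e)" using pos_sandwich[OF le inv_pair_sym[OF m(2)]] by simp
  then have "spec X \<subseteq> {\<delta>..}" using pos_diff_scaled_unit[OF m(1)] by simp
  \<comment> \<open>The hypothesis provides the positive lower end \<open>\<delta>\<close> itself,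
    so \<open>u >= 1\<close> on the whole interval.\<close>
  then have sp: "spec X \<subseteq> {\<delta>..norm X}" using spec_bound[OF m(1)] by force
  obtain K where K: "\<forall>i<5. has_cfc X (chain_fun i \<delta> \<alpha>) (K i)"
    "bound_I U e \<delta> \<alpha> \<beta> A B = ?c * K 0 * ?c"
    "bound_II U e \<delta> \<alpha> \<beta> A B = ?c * K 1 * ?c"
    "rel_entropy U e \<alpha> \<beta> A B = ?c * K 2 * ?c"
    "bound_III U e \<delta> \<alpha> \<beta> A B = ?c * K 3 * ?c"
    "bound_V U e \<delta> \<alpha> \<beta> A B = ?c * K 4 * ?c"
    using bounds_as_cfc[OF m(1) sp d d X_def] by blast
  have step: "pos (?c * K j * ?c - ?c * K i * ?c)"
    if "i < 5" "j < 5" "\<And>u. 1 \<le> u \<Longrightarrow> log_chain i u \<le> log_chain j u" for i j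
  proof (rule sandwich_mono[OF m(1) sp m(2) K(1)[rule_format, OF that(1)] _ K(1)[rule_format, OF that(2)]])
    fix t assume "t \<in> {\<delta>..norm X}"
    then have "1 \<le> sqrt (t / \<delta>)" using d by simp
    then show "chain_fun i \<delta> \<alpha> t \<le> chain_fun j \<delta> \<alpha> t"
      unfolding chain_fun_def by (intro mult_left_mono add_left_mono that(3)) auto
  qed (use that d in \<open>auto intro!: continuous_on_chain_fun\<close>)
  show ?thesis
    unfolding K(2-6) One_nat_def by (intro conjI step log_chain_mono_step) auto
qed

theorem entropy_bounds_below:
  assumes A: "pos A" "invertible_in U e A" and B: "pos B" "invertible_in U e B"
    and d: "0 < \<delta>" and le: "pos (\<delta> *\<^sub>R rpow U e A \<beta> - B)"
  shows "pos (bound_III U e \<delta> \<alpha> \<beta> A B - bound_V U e \<delta> \<alpha> \<beta> A B) \<and>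
    pos (rel_entropy U e \<alpha> \<beta> A B - bound_III U e \<delta> \<alpha> \<beta> A B) \<and>
    pos (bound_II U e \<delta> \<alpha> \<beta> A B - rel_entropy U e \<alpha> \<beta> A B) \<and>
    pos (bound_I U e \<delta> \<alpha> \<beta> A B - bound_II U e \<delta> \<alpha> \<beta> A B)"
proof -
  define X where "X = rel_elem U e \<beta> A B"
  let ?c = "rpow U e A (\<beta>/2)" and ?d = "rpow U e A (- \<beta>/2)"
  obtain m where m: "0 < m" "X \<in> S" "spec X \<subseteq> {m..norm X}" "inv_pair ?c ?d" "?c * ?c = rpow U e A \<beta>"
    unfolding X_def by (rule rel_elem_facts[OF A B])
  have "- X - (- \<delta>) *\<^sub>R e = ?d * (\<delta> *\<^sub>R rpow U e A \<beta> - B) * ?d"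
    using conjugate_unit[OF m(4)] by (simp add: X_def rel_elem_def algebra_simps m(5))
  then have pX: "pos (\<delta> *\<^sub>R e - X)" using pos_sandwich[OF le inv_pair_sym[OF m(4)]] by simp
  \<comment> \<open>For \<open>t > \<delta>\<close> the invertible element
    \<open>(\<delta> - X) + (t - \<delta>)\<close> is \<open>-(X - t)\<close>.\<close>
  have "t \<le> \<delta>" if "t \<in> spec X" for t
  proof (rule ccontr)
    assume "\<not> t \<le> \<delta>"
    then obtain b where "inv_pair (\<delta> *\<^sub>R e - X + (t - \<delta>) *\<^sub>R e) b" using pos_invertible[OF pX] by force
    then have "inv_pair (X - t *\<^sub>R e) (- b)" using inv_pair_minus by (fastforce simp: algebra_simps)
    then show False using that spec_iff[OF m(2)] by blast
  qed
  \<comment> \<open>Here the hypothesis bounds the spectrum only from above; the positive lower end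
    comes from the invertibility of \<open>X\<close>.\<close>
  then have sp: "spec X \<subseteq> {m..\<delta>}" using m(3) by force
  obtain K where K: "\<forall>i<5. has_cfc X (chain_fun i \<delta> \<alpha>) (K i)"
    "bound_I U e \<delta> \<alpha> \<beta> A B = ?c * K 0 * ?c"
    "bound_II U e \<delta> \<alpha> \<beta> A B = ?c * K 1 * ?c"
    "rel_entropy U e \<alpha> \<beta> A B = ?c * K 2 * ?c"
    "bound_III U e \<delta> \<alpha> \<beta> A B = ?c * K 3 * ?c"
    "bound_V U e \<delta> \<alpha> \<beta> A B = ?c * K 4 * ?c"
    using bounds_as_cfc[OF m(2) sp m(1) d X_def] by blast
  have step: "pos (?c * K j * ?c - ?c * K i * ?c)"
    if "i < 5" "j < 5" "\<And>u. 0 < u \<Longrightarrow> u \<le> 1 \<Longrightarrow> log_chain i u \<le> log_chain j u" for i j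
  proof (rule sandwich_mono[OF m(2) sp m(4) K(1)[rule_format, OF that(1)] _ K(1)[rule_format, OF that(2)]])
    fix t assume "t \<in> {m..\<delta>}"
    then have "0 < sqrt (t / \<delta>)" "sqrt (t / \<delta>) \<le> 1" using d m(1) by simp_all
    then show "chain_fun i \<delta> \<alpha> t \<le> chain_fun j \<delta> \<alpha> t"
      unfolding chain_fun_def by (intro mult_left_mono add_left_mono that(3)) auto
  qed (use that d m(1) in \<open>auto intro!: continuous_on_chain_fun\<close>)
  show ?thesis
    unfolding K(2-6) One_nat_def by (intro conjI step log_chain_antimono_step) auto
qed

end

section \<open>C*-algebras and JC-algebras\<close>

instance cstar_identity_algebra \<subseteq> banach ..

section \<open>Self-adjoint parts of complex and real C*-algebras\<close>

lemma adj_one: "adj (1::'a::cstar_identity_algebra) = 1"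
  by (metis adj_adj adj_mult mult_1)

lemma adj_minus: "adj (- x) = - adj (x::'a::cstar_identity_algebra)"
  using adj_scaleR[of "-1" x] by simp

lemma adj_diff: "adj (x - y) = adj x - adj (y::'a::cstar_identity_algebra)"
  using adj_add[of x "- y"] by (simp add: adj_minus)

lemma norm_adj: "norm (adj x) = norm (x::'a::cstar_identity_algebra)"
proof -
  have le: "norm y \<le> norm (adj y)" for y :: 'a
  proof (cases "y = 0")
    case False
    have "norm y * norm y \<le> norm (adj y) * norm y"
      using cstar_identity[of y] norm_mult_ineq[of "adj y" y] by (simp add: power2_eq_square)
    then show ?thesis using False by simp
  qed simp
  show ?thesis using le[of x] le[of "adj x"] by (simp add: adj_adj)
qed

lemma bounded_linear_adj: "bounded_linear (adj :: 'a::cstar_identity_algebra \<Rightarrow> 'a)"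
  by (rule bounded_linear_intro[where K = 1]) (simp_all add: adj_add adj_scaleR norm_adj)

lemma selfadjoint_inverse:
  fixes a b :: "'a::cstar_identity_algebra"
  assumes "adj a = a" "a * b = 1" "b * a = 1"
  shows "adj b = b"
proof -
  have "adj b * a = 1" using assms by (metis adj_mult adj_one)
  then show ?thesis using assms(2) by (metis mult.assoc mult_1 mult_1_right)
qed

text \<open>Only an inverse somewhere in the algebra is asked for; being the inverse of a
  self-adjoint element, it is self-adjoint.\<close>

lemma selfadjoint_calculus:
  assumes inv: "\<And>a::'a::cstar_identity_algebra. adj a = a \<Longrightarrow> \<exists>b. (1 + a * a) * b = 1 \<and> b * (1 + a * a) = 1"
  shows "jordan_calculus UNIV {a::'a. adj a = a} 1"
proof
  show "subspace {a::'a. adj a = a}"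
    using adj_scaleR[of 0] by (auto simp: subspace_def adj_add adj_scaleR)
  show "closed {a::'a. adj a = a}"
    by (intro closed_Collect_eq linear_continuous_on bounded_linear_adj continuous_on_id)
  show "norm (a * a) = (norm a)\<^sup>2" if "a \<in> {a. adj a = a}" for a :: 'a
    using that cstar_identity[of a] by simp
  show "\<exists>b\<in>{a. adj a = a}. (1 + a * a) * b = 1 \<and> b * (1 + a * a) = 1" if a: "a \<in> {a. adj a = a}" for a :: 'a
  proof -
    obtain b where b: "(1 + a * a) * b = 1" "b * (1 + a * a) = 1" using inv[of a] a by auto
    have "adj (1 + a * a) = 1 + a * a" using that by (simp add: adj_add adj_mult adj_one)
    from selfadjoint_inverse[OF this b] b show ?thesis by auto
  qed
qed (auto simp: adj_one adj_mult intro: selfadjoint_inverse)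

lemma scaleC_minus_left: "(- z) *\<^sub>C x = - (z *\<^sub>C (x::'a::complex_scalar_space))"
proof -
  have "0 *\<^sub>C x = 0" using scaleC_add_left[of 0 0 x] by simp
  then show ?thesis using scaleC_add_left[of z "- z" x] by (simp add: eq_neg_iff_add_eq_0 add.commute)
qed

lemma scaleC_one_left: "1 *\<^sub>C x = (x::'a::complex_scalar_space)"
  using scaleR_scaleC[of 1 x] by simp

text \<open>Arens' trick: for self-adjoint \<open>h\<close>, \<open>\<parallel>h + i\<tau>\<parallel>\<^sup>2 \<le> \<parallel>h\<parallel>\<^sup>2 + \<tau>\<^sup>2\<close> by the C*-identity, and for
  \<open>\<tau> = kr\<close> with \<open>k\<close> large this is smaller than \<open>(\<tau> + r)\<^sup>2\<close>.\<close>
lemma selfadjoint_resolvent: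
  fixes a :: "'a::cstar_algebra"
  assumes a: "adj a = a" and z: "Im z \<noteq> 0"
  shows "\<exists>b. (a - z *\<^sub>C 1) * b = 1 \<and> b * (a - z *\<^sub>C 1) = 1"
proof -
  define h r where "h = a - Re z *\<^sub>R 1" and "r = Im z"
  have h: "adj h = h" by (simp add: h_def adj_diff adj_scaleR adj_one a)
  have r: "r \<noteq> 0" using z by (simp add: r_def)
  \<comment> \<open>This choice gives \<open>norm h\<close> squared the value \<open>k r^2\<close>,
    and \<open>(k + 1)^2 r^2\<close> exceeds \<open>k r^2 + k^2 r^2\<close> by
    \<open>(k + 1) r^2 > 0\<close>.\<close>
  define k where "k = (norm h)\<^sup>2 / r\<^sup>2"
  have k: "k \<ge> 0" by (simp add: k_def)
  let ?t = "\<i> * complex_of_real (k * r)"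
  define y where "y = h + ?t *\<^sub>C 1"
  \<comment> \<open>\<open>a - z = h - ir\<close> equals \<open>y - c\<close>, and
    \<open>norm y < cmod c\<close> makes the Neumann series in \<open>y/c\<close> converge.\<close>
  define c where "c = \<i> * complex_of_real ((k + 1) * r)"
  have "adj y * y = (h + (- ?t) *\<^sub>C 1) * (h + ?t *\<^sub>C 1)"
    by (simp add: y_def adj_add h adj_scaleC adj_one)
  also have "\<dots> = h * h - (?t * ?t) *\<^sub>C 1"
    by (simp add: distrib_left left_diff_distrib scaleC_diff_right scaleC_minus_left mult_scaleC_left
        mult_scaleC_right scaleC_scaleC)
  also have "?t * ?t = - complex_of_real ((k * r)\<^sup>2)"
    by (simp add: complex_eq_iff power2_eq_square)
  also have "h * h - (- complex_of_real ((k * r)\<^sup>2)) *\<^sub>C 1 = h * h + (k * r)\<^sup>2 *\<^sub>R 1"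
    by (simp only: scaleC_minus_left scaleR_scaleC) simp
  finally have "(norm y)\<^sup>2 = norm (h * h + (k * r)\<^sup>2 *\<^sub>R 1)"
    using cstar_identity[of y] by simp
  also have "\<dots> \<le> norm (h * h) + (k * r)\<^sup>2"
    using norm_triangle_ineq[of "h * h" "(k * r)\<^sup>2 *\<^sub>R 1"] by simp
  also have "\<dots> = k * r\<^sup>2 + (k * r)\<^sup>2"
    using cstar_identity[of h] h r by (simp add: k_def)
  also have "\<dots> < ((k + 1) * r)\<^sup>2"
  proof -
    have "((k + 1) * r)\<^sup>2 - (k * r\<^sup>2 + (k * r)\<^sup>2) = (k + 1) * r\<^sup>2"
      by (simp add: power2_eq_square algebra_simps)
    moreover have "(k + 1) * r\<^sup>2 > 0" using k r by (intro mult_pos_pos) auto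
    ultimately show ?thesis by linarith
  qed
  also have "\<dots> = (cmod c)\<^sup>2" by (simp add: c_def norm_mult abs_mult power_mult_distrib)
  finally have "norm y < cmod c" by (rule power2_less_imp_less) simp
  moreover have c0: "c \<noteq> 0"
  proof -
    have "(k + 1) * r \<noteq> 0" using r k by simp
    then show ?thesis unfolding c_def by (simp del: of_real_mult of_real_add)
  qed
  ultimately have "norm ((1 / c) *\<^sub>C y) < 1" by (simp add: norm_scaleC norm_divide)
  then obtain b where b: "(1 - (1 / c) *\<^sub>C y) * b = 1" "b * (1 - (1 / c) *\<^sub>C y) = 1"
    using neumann_series[of 1 "(1 / c) *\<^sub>C y"] by auto
  have "a - z *\<^sub>C 1 = y - c *\<^sub>C 1"
  proof -
    have "z = complex_of_real (Re z) + (c - ?t)"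
      by (simp add: complex_eq_iff c_def r_def algebra_simps)
    then have "z *\<^sub>C (1::'a) = Re z *\<^sub>R 1 + (c *\<^sub>C 1 - ?t *\<^sub>C 1)"
      by (metis scaleC_add_left scaleC_minus_left scaleR_scaleC diff_conv_add_uminus)
    then show ?thesis by (simp add: y_def h_def)
  qed
  also have "\<dots> = (- c) *\<^sub>C (1 - (1 / c) *\<^sub>C y)"
    using c0 by (simp add: scaleC_diff_right scaleC_minus_left scaleC_scaleC scaleC_one_left)
  finally have eq: "a - z *\<^sub>C 1 = (- c) *\<^sub>C (1 - (1 / c) *\<^sub>C y)" .
  show ?thesis
    unfolding eq using b c0
    by (intro exI[of _ "(- 1 / c) *\<^sub>C b"])
      (simp add: mult_scaleC_left mult_scaleC_right scaleC_scaleC scaleC_one_left)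
qed

lemma cstar_jordan_calculus: "jordan_calculus UNIV {a::'a::cstar_algebra. adj a = a} 1"
proof (rule selfadjoint_calculus)
  fix a :: 'a assume a: "adj a = a"
  obtain p where p: "(a - \<i> *\<^sub>C 1) * p = 1" "p * (a - \<i> *\<^sub>C 1) = 1"
    using selfadjoint_resolvent[OF a, of \<i>] by auto
  obtain q where q: "(a - (- \<i>) *\<^sub>C 1) * q = 1" "q * (a - (- \<i>) *\<^sub>C 1) = 1"
    using selfadjoint_resolvent[OF a, of "- \<i>"] by auto
  have eq: "1 + a * a = (a - \<i> *\<^sub>C 1) * (a - (- \<i>) *\<^sub>C 1)"
    by (simp add: scaleC_minus_left left_diff_distrib distrib_left scaleC_add_right mult_scaleC_left
        mult_scaleC_right scaleC_diff_right scaleC_scaleC scaleC_one_left)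
  have "(1 + a * a) * (q * p) = (a - \<i> *\<^sub>C 1) * ((a - (- \<i>) *\<^sub>C 1) * q) * p"
    by (simp only: eq mult.assoc)
  moreover have "(q * p) * (1 + a * a) = q * (p * (a - \<i> *\<^sub>C 1)) * (a - (- \<i>) *\<^sub>C 1)"
    by (simp only: eq mult.assoc)
  ultimately show "\<exists>b. (1 + a * a) * b = 1 \<and> b * (1 + a * a) = 1"
    using p q by (intro exI[of _ "q * p"]) simp
qed

lemma cstar_positive_iff:
  "cstar_positive a \<longleftrightarrow> jordan_calculus.pos UNIV {a::'a::cstar_algebra. adj a = a} 1 a"
proof -
  interpret jordan_calculus UNIV "{a::'a. adj a = a}" 1 by (rule cstar_jordan_calculus)
  have "cstar_spectrum a = complex_of_real ` spec a" if a: "adj a = a"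
  proof -
    have "z \<in> cstar_spectrum a \<longleftrightarrow> z \<in> complex_of_real ` spec a" for z
    proof (cases "Im z = 0")
      case True
      then have z: "z = complex_of_real (Re z)" by (simp add: complex_eq_iff)
      have "z \<in> cstar_spectrum a \<longleftrightarrow> Re z \<in> spec a"
        by (subst z) (simp add: cstar_spectrum_def real_spectrum_def scaleR_scaleC)
      then show ?thesis using z by (metis Re_complex_of_real imageE image_eqI)
    next
      case False
      then show ?thesis
        using selfadjoint_resolvent[OF a False] by (auto simp: cstar_spectrum_def invertible_in_def)
    qed
    then show ?thesis by blast
  qed
  moreover have "complex_of_real ` spec a \<subseteq> \<real>\<^sub>\<ge>\<^sub>0 \<longleftrightarrow> spec a \<subseteq> {0..}"
    unfolding image_subset_iff by (auto simp: complex_nonneg_Reals_iff)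
  ultimately show ?thesis
    by (auto simp: cstar_positive_def pos_def)
qed

lemma real_cstar_jordan_calculus: "jordan_calculus UNIV {a::'a::real_cstar_algebra. adj a = a} 1"
  by (rule selfadjoint_calculus) (metis one_plus_invertible)

lemma real_cstar_positive_iff:
  "real_cstar_positive a \<longleftrightarrow> jordan_calculus.pos UNIV {a::'a::real_cstar_algebra. adj a = a} 1 a"
proof -
  interpret jordan_calculus UNIV "{a::'a. adj a = a}" 1 by (rule real_cstar_jordan_calculus)
  have "real_cstar_spectrum a = complex_of_real ` spec a" if a: "adj a = a"
  proof -
    have S: "a - s *\<^sub>R 1 \<in> {a. adj a = a}" for s using a by (simp add: adj_diff adj_scaleR adj_one)
    have "z \<in> real_cstar_spectrum a \<longleftrightarrow> z \<in> complex_of_real ` spec a" for z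
    proof (cases "Im z = 0")
      case True
      let ?w = "a - Re z *\<^sub>R 1"
      \<comment> \<open>At a real point the quadratic that defines the spectrum degenerates to a
        square, which is invertible exactly when its root is.\<close>
      have "(\<exists>b. inv_pair (?w * ?w) b) \<longleftrightarrow> (\<exists>b. inv_pair ?w b)"
        using inv_pair_mult[of ?w _ ?w _, OF _ _ refl] inv_pair_factor[OF _ S S refl] by blast
      then have "invertible_in UNIV 1 (?w\<^sup>2) \<longleftrightarrow> invertible_in UNIV 1 ?w"
        by (simp only: power2_eq_square invertible_in_iff[OF S] invertible_in_iff[OF square_in[OF S]])
      then have "z \<in> real_cstar_spectrum a \<longleftrightarrow> Re z \<in> spec a"
        using True by (simp add: real_cstar_spectrum_def real_spectrum_def)
      moreover have "z = complex_of_real (Re z)" using True by (simp add: complex_eq_iff)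
      ultimately show ?thesis by (metis Re_complex_of_real imageE image_eqI)
    next
      case False
      have "\<exists>b. inv_pair ((a - Re z *\<^sub>R 1) * (a - Re z *\<^sub>R 1) + (Im z)\<^sup>2 *\<^sub>R 1) b"
        using a False by (intro shifted_square_invertible) auto
      then have "z \<notin> real_cstar_spectrum a"
        by (auto simp: real_cstar_spectrum_def invertible_in_def inv_pair_def power2_eq_square)
      then show ?thesis using False by auto
    qed
    then show ?thesis by blast
  qed
  moreover have "complex_of_real ` spec a \<subseteq> \<real>\<^sub>\<ge>\<^sub>0 \<longleftrightarrow> spec a \<subseteq> {0..}"
    unfolding image_subset_iff by (auto simp: complex_nonneg_Reals_iff)
  ultimately show ?thesis
    by (auto simp: real_cstar_positive_def pos_def)
qed

instance complex_hilbert \<subseteq> banach ..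

section \<open>Hilbert space and the completeness of B(H)\<close>

lemma cinner_scaleC_left: "cinner (c *\<^sub>C x) y = cnj c * cinner x (y::'a::complex_hilbert)"
  by (metis cinner_commute cinner_scaleC_right complex_cnj_mult)

lemma cinner_scaleR_right: "cinner x (r *\<^sub>R y) = of_real r * cinner x (y::'a::complex_hilbert)"
  by (simp add: scaleR_scaleC cinner_scaleC_right)

lemma cinner_diff_right: "cinner x (y - z) = cinner x y - cinner x (z::'a::complex_hilbert)"
  using cinner_add_right[of x "y - z" z] by simp

lemma Re_cinner_commute: "Re (cinner x y) = Re (cinner y (x::'a::complex_hilbert))"
  using cinner_commute[of x y] by simp

lemma norm_add_hilbert: "(norm (x + y))\<^sup>2 = (norm x)\<^sup>2 + 2 * Re (cinner x y) + (norm (y::'a::complex_hilbert))\<^sup>2"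
proof -
  have "(norm (x + y))\<^sup>2 = Re (cinner (x + y) (x + y))" by (simp add: cinner_self)
  also have "\<dots> = Re (cinner x (x + y)) + Re (cinner y (x + y))"
    using Re_cinner_commute[of "x + y" "x + y"]
    by (metis Re_cinner_commute cinner_add_right plus_complex.simps(1))
  also have "\<dots> = (norm x)\<^sup>2 + 2 * Re (cinner x y) + (norm y)\<^sup>2"
    using Re_cinner_commute[of y x] by (simp add: cinner_add_right cinner_self)
  finally show ?thesis .
qed

lemma norm_diff_hilbert: "(norm (x - y))\<^sup>2 = (norm x)\<^sup>2 - 2 * Re (cinner x y) + (norm (y::'a::complex_hilbert))\<^sup>2"
  using norm_add_hilbert[of x "(- 1) *\<^sub>R y"] by (simp only: cinner_scaleR_right) simp

text \<open>Cauchy-Schwarz for the real part, read off from the triangle inequality, which the norm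
  has by assumption.\<close>

lemma Re_cinner_le: "Re (cinner x y) \<le> norm x * norm (y::'a::complex_hilbert)"
proof -
  have "(norm (x + y))\<^sup>2 \<le> (norm x + norm y)\<^sup>2"
    by (intro power_mono norm_triangle_ineq) auto
  then show ?thesis unfolding norm_add_hilbert by (simp add: power2_sum)
qed

lemma norm_scaleC_hilbert: "norm (z *\<^sub>C x) = cmod z * norm (x::'a::complex_hilbert)"
proof -
  have "complex_of_real ((norm (z *\<^sub>C x))\<^sup>2) = cnj z * z * complex_of_real ((norm x)\<^sup>2)"
    by (simp only: cinner_self[symmetric] cinner_scaleC_left cinner_scaleC_right mult.assoc mult.left_commute)
  also have "\<dots> = complex_of_real ((cmod z * norm x)\<^sup>2)"
    using complex_norm_square[of z] by (simp add: power_mult_distrib mult.commute)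
  finally have "(norm (z *\<^sub>C x))\<^sup>2 = (cmod z * norm x)\<^sup>2" by (simp only: of_real_eq_iff)
  then show ?thesis by (simp add: power2_eq_iff_nonneg)
qed

lemma bounded_linear_scaleC_hilbert: "bounded_linear (\<lambda>x::'a::complex_hilbert. z *\<^sub>C x)"
  by (rule bounded_linear_intro[where K = "cmod z"])
    (simp_all add: scaleC_add_right scaleC_scaleR_commute norm_scaleC_hilbert)

lemma op_apply_simps:
  "op_apply (S + T) x = op_apply S x + op_apply T x"
  "op_apply (S - T) x = op_apply S x - op_apply T x"
  "op_apply (S * T) x = op_apply S (op_apply T x)"
  "op_apply (r *\<^sub>R T) x = r *\<^sub>R op_apply T x"
  by (simp_all add: plus_cbop.rep_eq minus_cbop.rep_eq times_cbop.rep_eq scaleR_cbop.rep_eq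
      blinfun.add_left blinfun.diff_left blinfun.scaleR_left)

lemma norm_op_apply: "norm (op_apply T x) \<le> norm T * norm x"
  by (simp add: norm_cbop.rep_eq norm_blinfun)

lemma norm_op_bound: "0 \<le> b \<Longrightarrow> (\<And>x. norm (op_apply T x) \<le> b * norm x) \<Longrightarrow> norm T \<le> b"
  by (simp add: norm_cbop.rep_eq norm_blinfun_bound)

instance cbop :: (complex_hilbert) banach
proof
  fix X :: "nat \<Rightarrow> 'a cbop"
  assume X: "Cauchy X"
  have dist_eq: "dist S T = dist (op_blinfun S) (op_blinfun T)" for S T :: "'a cbop"
    by (simp add: dist_norm norm_cbop.rep_eq minus_cbop.rep_eq)
  have "Cauchy (\<lambda>n. op_blinfun (X n))"
    using X by (simp add: Cauchy_def dist_eq)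
  then obtain f where f: "(\<lambda>n. op_blinfun (X n)) \<longlonglongrightarrow> f"
    using Cauchy_convergent_iff convergent_def by blast
  have lim: "(\<lambda>n. op_apply (X n) x) \<longlonglongrightarrow> blinfun_apply f x" for x
    by (intro blinfun.tendsto f tendsto_const)
  have "blinfun_apply f (z *\<^sub>C x) = z *\<^sub>C blinfun_apply f x" for z x
  proof (rule LIMSEQ_unique[OF lim])
    have "(\<lambda>n. z *\<^sub>C op_apply (X n) x) \<longlonglongrightarrow> z *\<^sub>C blinfun_apply f x"
      by (rule bounded_linear.tendsto[OF bounded_linear_scaleC_hilbert lim])
    moreover have "op_apply (X n) (z *\<^sub>C x) = z *\<^sub>C op_apply (X n) x" for n
      using op_blinfun[of "X n"] by simp
    ultimately show "(\<lambda>n. op_apply (X n) (z *\<^sub>C x)) \<longlonglongrightarrow> z *\<^sub>C blinfun_apply f x" by simp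
  qed
  then have "op_blinfun (Cbop f) = f" by (intro Cbop_inverse) simp
  then have "X \<longlonglongrightarrow> Cbop f"
    using f by (simp add: tendsto_iff dist_eq)
  then show "convergent X" by (rule convergentI)
qed

text \<open>From \<open>norm (T x)\<close> squared being the inner product of \<open>x\<close> with
  \<open>T (T x)\<close>. It gives the C*-identity for self-adjoint operators without constructing
  adjoints in B(H).\<close>

lemma norm_selfadjoint_square:
  assumes "selfadjoint_op T" shows "norm (T * T) = (norm T)\<^sup>2"
proof (rule antisym)
  show "norm (T * T) \<le> (norm T)\<^sup>2" using norm_mult_ineq[of T T] by (simp add: power2_eq_square)
  have "norm T \<le> sqrt (norm (T * T))"
  proof (rule norm_op_bound)
    fix x
    have "(norm (op_apply T x))\<^sup>2 = Re (cinner (op_apply T x) (op_apply T x))"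
      by (simp add: cinner_self)
    also have "\<dots> = Re (cinner x (op_apply (T * T) x))"
      using assms by (simp add: selfadjoint_op_def op_apply_simps)
    also have "\<dots> \<le> norm x * norm (op_apply (T * T) x)" by (rule Re_cinner_le)
    also have "\<dots> \<le> norm x * (norm (T * T) * norm x)"
      by (intro mult_left_mono norm_op_apply) simp
    also have "\<dots> = (sqrt (norm (T * T)) * norm x)\<^sup>2"
      by (simp add: power_mult_distrib) (simp add: power2_eq_square)
    finally show "norm (op_apply T x) \<le> sqrt (norm (T * T)) * norm x"
      by (rule power2_le_imp_le) simp
  qed simp
  then show "(norm T)\<^sup>2 \<le> norm (T * T)"
    by (metis norm_ge_zero power_mono real_sqrt_pow2)
qed

context
  fixes \<A> :: "'h::complex_hilbert cbop set" and e
  assumes JC: "JC_algebra \<A>" and unit: "jordan_unit \<A> e"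
begin

section \<open>JC-algebras\<close>

lemma JC_selfadjoint: "T \<in> \<A> \<Longrightarrow> selfadjoint_op T"
  using JC by (simp add: JC_algebra_def)

lemma JC_move: "T \<in> \<A> \<Longrightarrow> cinner (op_apply T x) y = cinner x (op_apply T y)"
  using JC_selfadjoint by (simp add: selfadjoint_op_def)

text \<open>The Jordan condition says only \<open>eT + Te = 2T\<close>. Applied to \<open>e\<close>
  it gives \<open>ee = e\<close>; multiplied by \<open>e\<close> on either side it gives
  \<open>eTe = eT\<close> and \<open>eTe = Te\<close>, so \<open>e\<close> and \<open>T\<close>
  commute.\<close>

lemma JC_unit:
  assumes T: "T \<in> \<A>" shows "e * T = T" "T * e = T"
proof -
  have 2: "e * T + T * e = 2 *\<^sub>R T" if "T \<in> \<A>" for T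
  proof -
    have "(1/2) *\<^sub>R (e * T + T * e) = T" using unit that by (simp add: jordan_unit_def jordan_prod_def)
    then have "2 *\<^sub>R ((1/2) *\<^sub>R (e * T + T * e)) = 2 *\<^sub>R T" by (simp only:)
    then show ?thesis by simp
  qed
  have "e \<in> \<A>" using unit by (simp add: jordan_unit_def)
  from 2[OF this] have ee: "e * e = e" by (simp flip: scaleR_2)
  have "e * (e * T + T * e) = 2 *\<^sub>R (e * T)" "(e * T + T * e) * e = 2 *\<^sub>R (T * e)"
    using 2[OF T] by simp_all
  then have "e * T + e * T * e = 2 *\<^sub>R (e * T)" "e * T * e + T * e = 2 *\<^sub>R (T * e)"
    using ee by (simp_all add: distrib_left distrib_right mult.assoc) (metis ee mult.assoc)
  then have "e * T = T * e" by (simp add: scaleR_2) 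
  then show "e * T = T" "T * e = T" using 2[OF T] by (simp_all flip: scaleR_2)
qed

lemma JC_jordan_banach: "jordan_banach \<A> \<A> e"
proof
  show "subspace \<A>" "closed \<A>" using JC by (auto simp: JC_algebra_def)
  show "e \<in> \<A>" using unit by (simp add: jordan_unit_def)
  show "a * a \<in> \<A>" if "a \<in> \<A>" for a
  proof -
    have "jordan_prod a a \<in> \<A>" using JC that by (simp add: JC_algebra_def)
    then show ?thesis by (simp add: jordan_prod_def flip: scaleR_2)
  qed
qed (simp_all add: JC_unit norm_selfadjoint_square JC_selfadjoint)

interpretation J: jordan_banach \<A> \<A> e
  by (rule JC_jordan_banach)

lemma JC_unit_apply: "T \<in> \<A> \<Longrightarrow> op_apply T (op_apply e x) = op_apply T x"
  "T \<in> \<A> \<Longrightarrow> op_apply e (op_apply T x) = op_apply T x"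
  by (simp_all add: JC_unit flip: op_apply_simps(3))

text \<open>An inverse as an operator would not do, it must lie in the algebra. Coercivity yields
  \<open>norm (N e - W^2) < N\<close> for \<open>N\<close> the square of \<open>norm W\<close>, so
  \<open>W^2\<close> has an inverse given by a Neumann series, and then so does \<open>W\<close>.
  The square is taken because its quadratic form is \<open>norm (W x)\<close> squared, which is
  bounded below.\<close>

lemma JC_coercive_invertible:
  assumes W: "W \<in> \<A>" and t: "0 < t"
    and coercive: "\<And>x. t * (norm (op_apply e x))\<^sup>2 \<le> Re (cinner (op_apply e x) (op_apply W x))"
  shows "\<exists>b. J.inv_pair W b"
proof -
  define N where "N = (norm W)\<^sup>2"
  have N0: "N \<ge> 0" by (simp add: N_def)
  have below: "t * norm (op_apply e x) \<le> norm (op_apply W x)" for x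
  proof (cases "op_apply e x = 0")
    case False
    have "t * norm (op_apply e x) * norm (op_apply e x) \<le> norm (op_apply W x) * norm (op_apply e x)"
      using coercive[of x] Re_cinner_le[of "op_apply e x" "op_apply W x"]
      by (simp add: power2_eq_square mult.commute mult.left_commute)
    then show ?thesis using False by simp
  qed simp
  show ?thesis
  proof (cases "N = 0")
    case True
    \<comment> \<open>Coercivity of 0 forces \<open>e = 0\<close>, and then 0 is its own
      inverse.\<close>
    then have W0: "W = 0" by (simp add: N_def)
    have "norm (op_apply e x) \<le> 0" for x
      using below[of x] t by (simp add: W0 zero_cbop.rep_eq mult_le_0_iff)
    then have "norm e \<le> 0" by (intro norm_op_bound) auto
    then have "J.inv_pair W 0" using J.zero_in unfolding J.inv_pair_def by (simp add: W0)
    then show ?thesis by blast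
  next
    case False
    then have N: "N > 0" using N0 by simp
    \<comment> \<open>The maximum makes \<open>sqrt q\<close> meaningful without a proof that
      \<open>t^2 <= N\<close>.\<close>
    define q where "q = max 0 (N\<^sup>2 - N * t\<^sup>2)"
    have q: "0 \<le> q" "q < N\<^sup>2" using N t by (auto simp: q_def)
    have "norm (N *\<^sub>R e - W * W) \<le> sqrt q"
    proof (rule norm_op_bound)
      fix x
      let ?y = "op_apply e x" and ?w = "op_apply W x"
      have "(norm (op_apply (N *\<^sub>R e - W * W) x))\<^sup>2 = (norm (N *\<^sub>R ?y - op_apply W ?w))\<^sup>2"
        by (simp add: op_apply_simps)
      also have "\<dots> = N\<^sup>2 * (norm ?y)\<^sup>2 - 2 * N * Re (cinner ?y (op_apply W ?w)) + (norm (op_apply W ?w))\<^sup>2"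
        using Re_cinner_commute[of "N *\<^sub>R ?y"] Re_cinner_commute[of ?y]
        by (simp add: norm_diff_hilbert cinner_scaleR_right power_mult_distrib)
      also have "cinner ?y (op_apply W ?w) = complex_of_real ((norm ?w)\<^sup>2)"
        using W by (simp add: JC_unit_apply cinner_self flip: JC_move)
      also have "(norm (op_apply W ?w))\<^sup>2 \<le> N * (norm ?w)\<^sup>2"
        using power_mono[OF norm_op_apply[of W ?w], of 2] by (simp add: N_def power_mult_distrib)
      finally have "(norm (op_apply (N *\<^sub>R e - W * W) x))\<^sup>2 \<le> N\<^sup>2 * (norm ?y)\<^sup>2 - N * (norm ?w)\<^sup>2"
        by simp
      moreover have "N * (t\<^sup>2 * (norm ?y)\<^sup>2) \<le> N * (norm ?w)\<^sup>2"
        using power_mono[OF below[of x], of 2] N t by (simp add: power_mult_distrib)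
      ultimately have "(norm (op_apply (N *\<^sub>R e - W * W) x))\<^sup>2 \<le> (N\<^sup>2 - N * t\<^sup>2) * (norm ?y)\<^sup>2"
        by (simp add: algebra_simps)
      also have "\<dots> \<le> q * (norm ?y)\<^sup>2" by (intro mult_right_mono) (auto simp: q_def)
      also have "\<dots> \<le> q * (norm x)\<^sup>2"
      proof -
        have "norm ?y \<le> norm x"
          using norm_op_apply[of e x] mult_right_mono[OF J.norm_unit_le, of "norm x"] by simp
        then show ?thesis using q by (intro mult_left_mono power_mono) auto
      qed
      also have "\<dots> = (sqrt q * norm x)\<^sup>2" using q by (simp add: power_mult_distrib)
      finally show "norm (op_apply (N *\<^sub>R e - W * W) x) \<le> sqrt q * norm x"
        by (rule power2_le_imp_le) (use q in simp)
    qed (use q in simp)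
    also have "\<dots> < N" using q N by (simp add: real_sqrt_less_iff real_less_lsqrt)
    finally have "norm (N *\<^sub>R e - W * W) < N" .
    from J.neumann_scaled[OF _ this] obtain b where "J.inv_pair (W * W) b"
      using W by (auto intro: J.diff_in J.scale_in J.unit_in J.square_in)
    from J.inv_pair_factor[OF this W W refl] show ?thesis by blast
  qed
qed

lemma JC_jordan_calculus: "jordan_calculus \<A> \<A> e"
proof
  fix T assume T: "T \<in> \<A>"
  have "\<exists>b. J.inv_pair (e + T * T) b"
  proof (rule JC_coercive_invertible[where t = 1])
    fix x
    let ?y = "op_apply e x"
    have "cinner ?y (op_apply (e + T * T) x) = cinner ?y ?y + cinner (op_apply T x) (op_apply T x)"
      using T by (simp add: op_apply_simps cinner_add_right JC_unit_apply flip: JC_move)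
    then show "1 * (norm ?y)\<^sup>2 \<le> Re (cinner ?y (op_apply (e + T * T) x))"
      by (simp add: cinner_self)
  qed (use T in \<open>auto intro: J.add_in J.unit_in J.square_in\<close>)
  then show "\<exists>b\<in>\<A>. (e + T * T) * b = e \<and> b * (e + T * T) = e"
    by (auto simp: J.inv_pair_def)
qed

text \<open>If the quadratic form is nonnegative, \<open>T + t e\<close> is coercive with constant
  \<open>t\<close>, hence invertible. Conversely \<open>norm (r e - T) <= r\<close> with
  \<open>r = norm T\<close> and Cauchy-Schwarz leave a nonnegative form.\<close>

lemma JC_positive_iff:
  assumes T: "T \<in> \<A>"
  shows "op_positive T \<longleftrightarrow> jordan_calculus.pos \<A> \<A> e T"
proof -
  interpret jordan_calculus \<A> \<A> e by (rule JC_jordan_calculus)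
  show ?thesis
  proof
    assume P: "op_positive T"
    show "pos T"
    proof (rule posI[OF T])
      fix t :: real assume t: "t > 0"
      show "\<exists>b. J.inv_pair (T + t *\<^sub>R e) b"
      proof (rule JC_coercive_invertible[OF _ t])
        fix x
        let ?y = "op_apply e x"
        have "cinner ?y (op_apply (T + t *\<^sub>R e) x) = cinner x (op_apply T x) + of_real t * cinner ?y ?y"
          using T J.unit_in by (simp add: op_apply_simps cinner_add_right cinner_scaleR_right JC_unit_apply JC_move)
        moreover have "Re (cinner x (op_apply T x)) \<ge> 0"
          using P by (simp add: op_positive_def complex_nonneg_Reals_iff)
        ultimately show "t * (norm ?y)\<^sup>2 \<le> Re (cinner ?y (op_apply (T + t *\<^sub>R e) x))"
          by (simp add: cinner_self)
      qed (use T in \<open>auto intro: J.add_in J.unit_in J.scale_in\<close>)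
    qed
  next
    assume P: "pos T"
    show "op_positive T"
      unfolding op_positive_def
    proof (intro conjI allI)
      fix x
      let ?y = "op_apply e x" and ?r = "norm T"
      \<comment> \<open>\<open>T\<close> lives on the range of the projection \<open>e\<close>, so
        its form depends only on the component \<open>e x\<close>.\<close>
      have eq: "cinner x (op_apply T x) = cinner ?y (op_apply T ?y)"
        using T J.unit_in by (simp add: JC_unit_apply JC_move)
      have "Re (cinner ?y (op_apply (?r *\<^sub>R e - T) ?y)) \<le> norm ?y * norm (op_apply (?r *\<^sub>R e - T) ?y)"
        by (rule Re_cinner_le)
      also have "\<dots> \<le> norm ?y * (?r * norm ?y)"
      proof (rule mult_left_mono)
        have "norm (?r *\<^sub>R e - T) * norm ?y \<le> ?r * norm ?y"
          by (intro mult_right_mono pos_norm_le[OF P order_refl]) simp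
        with norm_op_apply[of "?r *\<^sub>R e - T" ?y]
        show "norm (op_apply (?r *\<^sub>R e - T) ?y) \<le> ?r * norm ?y" by linarith
      qed simp
      finally have "0 \<le> Re (cinner ?y (op_apply T ?y))"
        using J.unit_in by (simp add: op_apply_simps cinner_diff_right cinner_scaleR_right JC_unit_apply
            cinner_self power2_eq_square)
      moreover have "Im (cinner x (op_apply T x)) = 0"
        using cinner_commute[of x "op_apply T x"] JC_move[OF T, of x x] by (simp add: complex_eq_iff)
      ultimately show "cinner x (op_apply T x) \<in> \<real>\<^sub>\<ge>\<^sub>0"
        by (simp add: complex_nonneg_Reals_iff eq)
    qed (rule JC_selfadjoint[OF T])
  qed
qed

end

section \<open>Transfer to the three kinds of algebra\<close>

lemma cstar_entropy_bounds:
  fixes A B :: "'a::cstar_algebra"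
  assumes "cstar_positive A" "invertible_in UNIV 1 A" "cstar_positive B" "invertible_in UNIV 1 B" "0 < \<delta>"
  shows "\<delta> *\<^sub>R rpow UNIV 1 A \<beta> \<preceq>\<^sub>C B \<Longrightarrow>
      bound_I UNIV 1 \<delta> \<alpha> \<beta> A B \<preceq>\<^sub>C bound_II UNIV 1 \<delta> \<alpha> \<beta> A B \<and>
      bound_II UNIV 1 \<delta> \<alpha> \<beta> A B \<preceq>\<^sub>C rel_entropy UNIV 1 \<alpha> \<beta> A B \<and>
      rel_entropy UNIV 1 \<alpha> \<beta> A B \<preceq>\<^sub>C bound_III UNIV 1 \<delta> \<alpha> \<beta> A B \<and>
      bound_III UNIV 1 \<delta> \<alpha> \<beta> A B \<preceq>\<^sub>C bound_V UNIV 1 \<delta> \<alpha> \<beta> A B"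
    and "B \<preceq>\<^sub>C \<delta> *\<^sub>R rpow UNIV 1 A \<beta> \<Longrightarrow>
      bound_V UNIV 1 \<delta> \<alpha> \<beta> A B \<preceq>\<^sub>C bound_III UNIV 1 \<delta> \<alpha> \<beta> A B \<and>
      bound_III UNIV 1 \<delta> \<alpha> \<beta> A B \<preceq>\<^sub>C rel_entropy UNIV 1 \<alpha> \<beta> A B \<and>
      rel_entropy UNIV 1 \<alpha> \<beta> A B \<preceq>\<^sub>C bound_II UNIV 1 \<delta> \<alpha> \<beta> A B \<and>
      bound_II UNIV 1 \<delta> \<alpha> \<beta> A B \<preceq>\<^sub>C bound_I UNIV 1 \<delta> \<alpha> \<beta> A B"
  using assms unfolding cstar_le_def cstar_positive_iff
  by (simp_all add: jordan_calculus.entropy_bounds_above[OF cstar_jordan_calculus]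
      jordan_calculus.entropy_bounds_below[OF cstar_jordan_calculus])

lemma real_cstar_entropy_bounds:
  fixes A B :: "'a::real_cstar_algebra"
  assumes "real_cstar_positive A" "invertible_in UNIV 1 A" "real_cstar_positive B" "invertible_in UNIV 1 B"
    "0 < \<delta>"
  shows "\<delta> *\<^sub>R rpow UNIV 1 A \<beta> \<preceq>\<^sub>R B \<Longrightarrow>
      bound_I UNIV 1 \<delta> \<alpha> \<beta> A B \<preceq>\<^sub>R bound_II UNIV 1 \<delta> \<alpha> \<beta> A B \<and>
      bound_II UNIV 1 \<delta> \<alpha> \<beta> A B \<preceq>\<^sub>R rel_entropy UNIV 1 \<alpha> \<beta> A B \<and>
      rel_entropy UNIV 1 \<alpha> \<beta> A B \<preceq>\<^sub>R bound_III UNIV 1 \<delta> \<alpha> \<beta> A B \<and>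
      bound_III UNIV 1 \<delta> \<alpha> \<beta> A B \<preceq>\<^sub>R bound_V UNIV 1 \<delta> \<alpha> \<beta> A B"
    and "B \<preceq>\<^sub>R \<delta> *\<^sub>R rpow UNIV 1 A \<beta> \<Longrightarrow>
      bound_V UNIV 1 \<delta> \<alpha> \<beta> A B \<preceq>\<^sub>R bound_III UNIV 1 \<delta> \<alpha> \<beta> A B \<and>
      bound_III UNIV 1 \<delta> \<alpha> \<beta> A B \<preceq>\<^sub>R rel_entropy UNIV 1 \<alpha> \<beta> A B \<and>
      rel_entropy UNIV 1 \<alpha> \<beta> A B \<preceq>\<^sub>R bound_II UNIV 1 \<delta> \<alpha> \<beta> A B \<and>
      bound_II UNIV 1 \<delta> \<alpha> \<beta> A B \<preceq>\<^sub>R bound_I UNIV 1 \<delta> \<alpha> \<beta> A B"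
  using assms unfolding real_cstar_le_def real_cstar_positive_iff
  by (simp_all add: jordan_calculus.entropy_bounds_above[OF real_cstar_jordan_calculus]
      jordan_calculus.entropy_bounds_below[OF real_cstar_jordan_calculus])

lemma JC_entropy_bounds:
  fixes \<A> :: "'h::complex_hilbert cbop set"
  assumes JC: "JC_algebra \<A>" "jordan_unit \<A> e"
    and A: "A \<in> \<A>" "op_positive A" "invertible_in \<A> e A"
    and B: "B \<in> \<A>" "op_positive B" "invertible_in \<A> e B"
    and \<delta>: "0 < \<delta>"
  shows "\<delta> *\<^sub>R rpow \<A> e A \<beta> \<preceq>\<^sub>H B \<Longrightarrow>
      bound_I \<A> e \<delta> \<alpha> \<beta> A B \<preceq>\<^sub>H bound_II \<A> e \<delta> \<alpha> \<beta> A B \<and>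
      bound_II \<A> e \<delta> \<alpha> \<beta> A B \<preceq>\<^sub>H rel_entropy \<A> e \<alpha> \<beta> A B \<and>
      rel_entropy \<A> e \<alpha> \<beta> A B \<preceq>\<^sub>H bound_III \<A> e \<delta> \<alpha> \<beta> A B \<and>
      bound_III \<A> e \<delta> \<alpha> \<beta> A B \<preceq>\<^sub>H bound_V \<A> e \<delta> \<alpha> \<beta> A B"
    and "B \<preceq>\<^sub>H \<delta> *\<^sub>R rpow \<A> e A \<beta> \<Longrightarrow>
      bound_V \<A> e \<delta> \<alpha> \<beta> A B \<preceq>\<^sub>H bound_III \<A> e \<delta> \<alpha> \<beta> A B \<and>
      bound_III \<A> e \<delta> \<alpha> \<beta> A B \<preceq>\<^sub>H rel_entropy \<A> e \<alpha> \<beta> A B \<and>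
      rel_entropy \<A> e \<alpha> \<beta> A B \<preceq>\<^sub>H bound_II \<A> e \<delta> \<alpha> \<beta> A B \<and>
      bound_II \<A> e \<delta> \<alpha> \<beta> A B \<preceq>\<^sub>H bound_I \<A> e \<delta> \<alpha> \<beta> A B"
proof -
  interpret jordan_calculus \<A> \<A> e by (rule JC_jordan_calculus[OF JC])
  note iff = JC_positive_iff[OF JC]
  have AB: "pos A" "pos B" using A B iff by auto
  \<comment> \<open>Operator positivity agrees with \<open>pos\<close> only on members of the
    algebra, so the two sides of the hypothesis must first be known to belong to it. Here the power
    is the square of the power to \<open>\<beta>/2\<close>.\<close>
  have R: "rpow \<A> e A \<beta> \<in> \<A>"
    using rel_elem_facts[OF AB(1) A(3) AB(2) B(3), of \<beta>] by (metis inv_pair_def square_in)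
  have le: "X \<preceq>\<^sub>H Y" if "pos (Y - X)" for X Y
    using that iff[OF pos_in[OF that]] by (simp add: op_le_def)
  {
    assume "\<delta> *\<^sub>R rpow \<A> e A \<beta> \<preceq>\<^sub>H B"
    then have "pos (B - \<delta> *\<^sub>R rpow \<A> e A \<beta>)"
      using iff[OF diff_in[OF B(1) scale_in[OF R]]] by (simp add: op_le_def)
    from entropy_bounds_above[OF AB(1) A(3) AB(2) B(3) \<delta> this]
    show "bound_I \<A> e \<delta> \<alpha> \<beta> A B \<preceq>\<^sub>H bound_II \<A> e \<delta> \<alpha> \<beta> A B \<and>
      bound_II \<A> e \<delta> \<alpha> \<beta> A B \<preceq>\<^sub>H rel_entropy \<A> e \<alpha> \<beta> A B \<and>
      rel_entropy \<A> e \<alpha> \<beta> A B \<preceq>\<^sub>H bound_III \<A> e \<delta> \<alpha> \<beta> A B \<and>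
      bound_III \<A> e \<delta> \<alpha> \<beta> A B \<preceq>\<^sub>H bound_V \<A> e \<delta> \<alpha> \<beta> A B"
      by (blast intro: le)
  next
    assume "B \<preceq>\<^sub>H \<delta> *\<^sub>R rpow \<A> e A \<beta>"
    then have "pos (\<delta> *\<^sub>R rpow \<A> e A \<beta> - B)"
      using iff[OF diff_in[OF scale_in[OF R] B(1)]] by (simp add: op_le_def)
    from entropy_bounds_below[OF AB(1) A(3) AB(2) B(3) \<delta> this]
    show "bound_V \<A> e \<delta> \<alpha> \<beta> A B \<preceq>\<^sub>H bound_III \<A> e \<delta> \<alpha> \<beta> A B \<and>
      bound_III \<A> e \<delta> \<alpha> \<beta> A B \<preceq>\<^sub>H rel_entropy \<A> e \<alpha> \<beta> A B \<and>
      rel_entropy \<A> e \<alpha> \<beta> A B \<preceq>\<^sub>H bound_II \<A> e \<delta> \<alpha> \<beta> A B \<and>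
      bound_II \<A> e \<delta> \<alpha> \<beta> A B \<preceq>\<^sub>H bound_I \<A> e \<delta> \<alpha> \<beta> A B"
      by (blast intro: le)
  }
qed

theorem theorem3p1:
  fixes \<alpha> \<beta> \<delta> :: real
  assumes "0 \<le> \<alpha>" and "0 \<le> \<beta>"
  shows
    "(\<forall>A B :: 'a::cstar_algebra.
        cstar_positive A \<and> invertible_in UNIV 1 A \<and> cstar_positive B \<and> invertible_in UNIV 1 B \<longrightarrow>
        (1 \<le> \<delta> \<and> \<delta> *\<^sub>R rpow UNIV 1 A \<beta> \<preceq>\<^sub>C B \<longrightarrow>
         bound_I UNIV 1 \<delta> \<alpha> \<beta> A B \<preceq>\<^sub>C bound_II UNIV 1 \<delta> \<alpha> \<beta> A B \<and>
         bound_II UNIV 1 \<delta> \<alpha> \<beta> A B \<preceq>\<^sub>C rel_entropy UNIV 1 \<alpha> \<beta> A B \<and>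
         rel_entropy UNIV 1 \<alpha> \<beta> A B \<preceq>\<^sub>C bound_III UNIV 1 \<delta> \<alpha> \<beta> A B \<and>
         bound_III UNIV 1 \<delta> \<alpha> \<beta> A B \<preceq>\<^sub>C bound_V UNIV 1 \<delta> \<alpha> \<beta> A B) \<and>
        (0 < \<delta> \<and> \<delta> \<le> 1 \<and> B \<preceq>\<^sub>C \<delta> *\<^sub>R rpow UNIV 1 A \<beta> \<longrightarrow>
         bound_V UNIV 1 \<delta> \<alpha> \<beta> A B \<preceq>\<^sub>C bound_III UNIV 1 \<delta> \<alpha> \<beta> A B \<and>
         bound_III UNIV 1 \<delta> \<alpha> \<beta> A B \<preceq>\<^sub>C rel_entropy UNIV 1 \<alpha> \<beta> A B \<and>
         rel_entropy UNIV 1 \<alpha> \<beta> A B \<preceq>\<^sub>C bound_II UNIV 1 \<delta> \<alpha> \<beta> A B \<and>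
         bound_II UNIV 1 \<delta> \<alpha> \<beta> A B \<preceq>\<^sub>C bound_I UNIV 1 \<delta> \<alpha> \<beta> A B)) \<and>
     (\<forall>A B :: 'b::real_cstar_algebra.
        real_cstar_positive A \<and> invertible_in UNIV 1 A \<and> real_cstar_positive B \<and> invertible_in UNIV 1 B \<longrightarrow>
        (1 \<le> \<delta> \<and> \<delta> *\<^sub>R rpow UNIV 1 A \<beta> \<preceq>\<^sub>R B \<longrightarrow>
         bound_I UNIV 1 \<delta> \<alpha> \<beta> A B \<preceq>\<^sub>R bound_II UNIV 1 \<delta> \<alpha> \<beta> A B \<and>
         bound_II UNIV 1 \<delta> \<alpha> \<beta> A B \<preceq>\<^sub>R rel_entropy UNIV 1 \<alpha> \<beta> A B \<and>
         rel_entropy UNIV 1 \<alpha> \<beta> A B \<preceq>\<^sub>R bound_III UNIV 1 \<delta> \<alpha> \<beta> A B \<and>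
         bound_III UNIV 1 \<delta> \<alpha> \<beta> A B \<preceq>\<^sub>R bound_V UNIV 1 \<delta> \<alpha> \<beta> A B) \<and>
        (0 < \<delta> \<and> \<delta> \<le> 1 \<and> B \<preceq>\<^sub>R \<delta> *\<^sub>R rpow UNIV 1 A \<beta> \<longrightarrow>
         bound_V UNIV 1 \<delta> \<alpha> \<beta> A B \<preceq>\<^sub>R bound_III UNIV 1 \<delta> \<alpha> \<beta> A B \<and>
         bound_III UNIV 1 \<delta> \<alpha> \<beta> A B \<preceq>\<^sub>R rel_entropy UNIV 1 \<alpha> \<beta> A B \<and>
         rel_entropy UNIV 1 \<alpha> \<beta> A B \<preceq>\<^sub>R bound_II UNIV 1 \<delta> \<alpha> \<beta> A B \<and>
         bound_II UNIV 1 \<delta> \<alpha> \<beta> A B \<preceq>\<^sub>R bound_I UNIV 1 \<delta> \<alpha> \<beta> A B)) \<and>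
     (\<forall>(\<A> :: 'h::complex_hilbert cbop set) e. JC_algebra \<A> \<and> jordan_unit \<A> e \<longrightarrow>
      (\<forall>A\<in>\<A>. \<forall>B\<in>\<A>.
        op_positive A \<and> invertible_in \<A> e A \<and> op_positive B \<and> invertible_in \<A> e B \<longrightarrow>
        (1 \<le> \<delta> \<and> \<delta> *\<^sub>R rpow \<A> e A \<beta> \<preceq>\<^sub>H B \<longrightarrow>
         bound_I \<A> e \<delta> \<alpha> \<beta> A B \<preceq>\<^sub>H bound_II \<A> e \<delta> \<alpha> \<beta> A B \<and>
         bound_II \<A> e \<delta> \<alpha> \<beta> A B \<preceq>\<^sub>H rel_entropy \<A> e \<alpha> \<beta> A B \<and>
         rel_entropy \<A> e \<alpha> \<beta> A B \<preceq>\<^sub>H bound_III \<A> e \<delta> \<alpha> \<beta> A B \<and>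
         bound_III \<A> e \<delta> \<alpha> \<beta> A B \<preceq>\<^sub>H bound_V \<A> e \<delta> \<alpha> \<beta> A B) \<and>
        (0 < \<delta> \<and> \<delta> \<le> 1 \<and> B \<preceq>\<^sub>H \<delta> *\<^sub>R rpow \<A> e A \<beta> \<longrightarrow>
         bound_V \<A> e \<delta> \<alpha> \<beta> A B \<preceq>\<^sub>H bound_III \<A> e \<delta> \<alpha> \<beta> A B \<and>
         bound_III \<A> e \<delta> \<alpha> \<beta> A B \<preceq>\<^sub>H rel_entropy \<A> e \<alpha> \<beta> A B \<and>
         rel_entropy \<A> e \<alpha> \<beta> A B \<preceq>\<^sub>H bound_II \<A> e \<delta> \<alpha> \<beta> A B \<and>
         bound_II \<A> e \<delta> \<alpha> \<beta> A B \<preceq>\<^sub>H bound_I \<A> e \<delta> \<alpha> \<beta> A B)))"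
  by (intro conjI allI ballI impI; elim conjE;
      simp add: cstar_entropy_bounds real_cstar_entropy_bounds JC_entropy_bounds)

end
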